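(* Let $R$ be $\mathbb Z[x_1,\ldots,x_k]$ or $\mathbb Z[x_1,x_1^{-1},\ldots,x_k,x_k^{-1}]$ ($k\ge1$), and let $(\Gamma,\phi)$ be the regular interpretation of $R$ in $\mathbb Z$ coming from a regular bi-interpretation of $R$ with $\mathbb Z$. Then every ring elementarily equivalent to $R$ is isomorphic to $\Gamma(\widetilde{\mathbb Z},\bar p)$ for some ring $\widetilde{\mathbb Z}\equiv\mathbb Z$ and some $\bar p\in\phi(\widetilde{\mathbb Z})$.
   Context: A regular interpretation $(\Gamma,\phi)$ of $\mathbb A$ in $\mathbb B$ is a code of $L(\mathbb B)$-formulas with parameters $\bar y$ defining a subset of $B^n$, an equivalence relation on it and the operations of $\mathbb A$ on the quotient, together with a formula $\phi(\bar y)$ with $\phi(\mathbb B)\ne\emptyset$, such that the resulting structure $\Gamma(\mathbb B,\bar p)\cong\mathbb A$ for every $\bar p\in\phi(\mathbb B)$; for a structure $\widetilde{\mathbb B}$ in the language of $\mathbb B$ and $\bar p\in\phi(\widetilde{\mathbb B})$, $\Gamma(\widetilde{\mathbb B},\bar p)$ is the structure obtained by applying the same formulas in $\widetilde{\mathbb B}$. A coordinate map is a surjection from the defined subset onto $A$ inducing such an isomorphism. A regular bi-interpretation of $\mathbb A$ and $\mathbb B$ consists of regular interpretations $(\Gamma,\phi)$ of $\mathbb A$ in $\mathbb B$ and $(\Delta,\psi)$ of $\mathbb B$ in $\mathbb A$ and formulas $\theta_{\mathbb A},\theta_{\mathbb B}$ such that for every admissible parameter tuple of the composite interpretation $\Gamma\circ\Delta$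 (resp. $\Delta\circ\Gamma$), $\theta_{\mathbb A}$ (resp. $\theta_{\mathbb B}$) with that parameter defines a coordinate map of $\Gamma\circ\Delta(\mathbb A,\cdot)$ onto $\mathbb A$ (resp. of $\Delta\circ\Gamma(\mathbb B,\cdot)$ onto $\mathbb B$). Such bi-interpretations of $R$ with $\mathbb Z$ exist. *)

theory Defs
  imports "HOL-Algebra.IntRing" "HOL-Library.Poly_Mapping"
begin

section \<open>First-order logic in the language of rings\<close>

text \<open>
  The language is \<open>{0, 1, +, *}\<close>; its structures are the records of type \<^typ>\<open>'a ring\<close>.
  Formulas use de Bruijn indices: under \<open>Ex\<close> the index 0 is the bound variable.  An environment is a
  list of elements, so that a formula \<open>F(x, y)\<close> with tuples \<open>x\<close>, \<open>y\<close> of free variables is evaluated at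
  \<open>x @ y\<close>.  A formula is only evaluated at lists covering its free variables.
\<close>

datatype rterm = Var nat | Zero | One | Add rterm rterm | Mul rterm rterm

datatype fm = Eq rterm rterm | Neg fm | Conj fm fm | Ex fm

primrec eval :: "'a ring \<Rightarrow> 'a list \<Rightarrow> rterm \<Rightarrow> 'a" where
  "eval S e (Var i) = e ! i"
| "eval S e Zero = \<zero>\<^bsub>S\<^esub>"
| "eval S e One = \<one>\<^bsub>S\<^esub>"
| "eval S e (Add s t) = eval S e s \<oplus>\<^bsub>S\<^esub> eval S e t"
| "eval S e (Mul s t) = eval S e s \<otimes>\<^bsub>S\<^esub> eval S e t"

primrec sat :: "'a ring \<Rightarrow> 'a list \<Rightarrow> fm \<Rightarrow> bool" where
  "sat S e (Eq s t) \<longleftrightarrow> eval S e s = eval S e t"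
| "sat S e (Neg F) \<longleftrightarrow> \<not> sat S e F"
| "sat S e (Conj F G) \<longleftrightarrow> sat S e F \<and> sat S e G"
| "sat S e (Ex F) \<longleftrightarrow> (\<exists>a\<in>carrier S. sat S (a # e) F)"

primrec fv_term :: "rterm \<Rightarrow> nat set" where
  "fv_term (Var i) = {i}"
| "fv_term Zero = {}"
| "fv_term One = {}"
| "fv_term (Add s t) = fv_term s \<union> fv_term t"
| "fv_term (Mul s t) = fv_term s \<union> fv_term t"

primrec fv :: "fm \<Rightarrow> nat set" where
  "fv (Eq s t) = fv_term s \<union> fv_term t"
| "fv (Neg F) = fv F"
| "fv (Conj F G) = fv F \<union> fv G"
| "fv (Ex F) = {i. Suc i \<in> fv F}"

definition elem_equiv :: "'a ring \<Rightarrow> 'b ring \<Rightarrow> bool" where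
  "elem_equiv S T \<longleftrightarrow> (\<forall>F. fv F = {} \<longrightarrow> sat S [] F = sat T [] F)"

text \<open>
  \<^const>\<open>ring_iso\<close> does not mention the zero element.  Its preservation is automatic between
  rings, but here one side may be a structure that is not yet known to be a ring.
\<close>

definition struct_iso :: "'a ring \<Rightarrow> 'b ring \<Rightarrow> ('a \<Rightarrow> 'b) set" where
  "struct_iso S T = {f \<in> ring_iso S T. f \<zero>\<^bsub>S\<^esub> = \<zero>\<^bsub>T\<^esub>}"

definition isomorphic :: "'a ring \<Rightarrow> 'b ring \<Rightarrow> bool" where
  "isomorphic S T \<longleftrightarrow> struct_iso S T \<noteq> {}"

definition tuples :: "'a ring \<Rightarrow> nat \<Rightarrow> 'a list set" where
  "tuples S n = {x. length x = n \<and> set x \<subseteq> carrier S}"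


section \<open>Codes and regular interpretations\<close>

text \<open>
  With \<open>n = dim\<close> and parameters \<open>y\<close> of length \<open>npar\<close>, the variables of the component formulas are
  \<open>dom_fm(x, y)\<close>, \<open>eq_fm(x, x', y)\<close>, \<open>zero_fm(x, y)\<close>, \<open>one_fm(x, y)\<close>, \<open>add_fm(x, x', x'', y)\<close> and
  \<open>mul_fm(x, x', x'', y)\<close>, where \<open>x, x', x''\<close> are \<open>n\<close>-tuples; the last two define the graphs
  \<open>x + x' = x''\<close> and \<open>x * x' = x''\<close>.
\<close>

record code =
  dim :: nat
  npar :: nat
  dom_fm :: fm
  eq_fm :: fm
  zero_fm :: fm
  one_fm :: fm
  add_fm :: fm
  mul_fm :: fm

definition is_code :: "code \<Rightarrow> bool" where
  "is_code C \<longleftrightarrow>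
     fv (dom_fm C) \<subseteq> {..<dim C + npar C} \<and>
     fv (eq_fm C) \<subseteq> {..<2 * dim C + npar C} \<and>
     fv (zero_fm C) \<subseteq> {..<dim C + npar C} \<and>
     fv (one_fm C) \<subseteq> {..<dim C + npar C} \<and>
     fv (add_fm C) \<subseteq> {..<3 * dim C + npar C} \<and>
     fv (mul_fm C) \<subseteq> {..<3 * dim C + npar C}"

definition code_dom :: "'a ring \<Rightarrow> code \<Rightarrow> 'a list \<Rightarrow> 'a list set" where
  "code_dom S C p = {x \<in> tuples S (dim C). sat S (x @ p) (dom_fm C)}"

definition code_rel :: "'a ring \<Rightarrow> code \<Rightarrow> 'a list \<Rightarrow> ('a list \<times> 'a list) set" where
  "code_rel S C p =
     {(x, x'). x \<in> code_dom S C p \<and> x' \<in> code_dom S C p \<and> sat S (x @ x' @ p) (eq_fm C)}"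

definition defines_op :: "'a ring \<Rightarrow> code \<Rightarrow> 'a list \<Rightarrow> fm \<Rightarrow> bool" where
  "defines_op S C p F \<longleftrightarrow>
     (\<forall>x x' y y' z z'. (x, x') \<in> code_rel S C p \<and> (y, y') \<in> code_rel S C p \<and>
        (z, z') \<in> code_rel S C p \<longrightarrow>
        sat S (x @ y @ z @ p) F = sat S (x' @ y' @ z' @ p) F) \<and>
     (\<forall>x\<in>code_dom S C p. \<forall>y\<in>code_dom S C p.
        {z \<in> code_dom S C p. sat S (x @ y @ z @ p) F} \<in> code_dom S C p // code_rel S C p)"

definition op_of :: "'a ring \<Rightarrow> code \<Rightarrow> 'a list \<Rightarrow> fm \<Rightarrow>
    'a list set \<Rightarrow> 'a list set \<Rightarrow> 'a list set" where
  "op_of S C p F c d = {z \<in> code_dom S C p. \<exists>x\<in>c. \<exists>y\<in>d. sat S (x @ y @ z @ p) F}"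

text \<open>
  The structure \<open>C(S, p)\<close> is \<open>interp S C p\<close>; it makes sense when \<open>interp_ok S C p\<close> holds, i.e. when the
  formulas define an equivalence relation and, on the quotient, constants and binary operations.
\<close>

definition interp :: "'a ring \<Rightarrow> code \<Rightarrow> 'a list \<Rightarrow> 'a list set ring" where
  "interp S C p =
     \<lparr>carrier = code_dom S C p // code_rel S C p,
      mult = op_of S C p (mul_fm C),
      one = {x \<in> code_dom S C p. sat S (x @ p) (one_fm C)},
      zero = {x \<in> code_dom S C p. sat S (x @ p) (zero_fm C)},
      add = op_of S C p (add_fm C)\<rparr>"

definition interp_ok :: "'a ring \<Rightarrow> code \<Rightarrow> 'a list \<Rightarrow> bool" where
  "interp_ok S C p \<longleftrightarrow>
     equiv (code_dom S C p) (code_rel S C p) \<and>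
     \<zero>\<^bsub>interp S C p\<^esub> \<in> carrier (interp S C p) \<and>
     \<one>\<^bsub>interp S C p\<^esub> \<in> carrier (interp S C p) \<and>
     defines_op S C p (add_fm C) \<and> defines_op S C p (mul_fm C)"

text \<open>The set \<open>F(S)\<close> of \<open>m\<close>-tuples defined by \<open>F\<close>.\<close>

definition defset :: "'a ring \<Rightarrow> nat \<Rightarrow> fm \<Rightarrow> 'a list set" where
  "defset S m F = {p \<in> tuples S m. sat S p F}"

definition regular_interpretation :: "code \<Rightarrow> fm \<Rightarrow> 'a ring \<Rightarrow> 'b ring \<Rightarrow> bool" where
  "regular_interpretation C \<phi> A B \<longleftrightarrow>
     is_code C \<and> fv \<phi> \<subseteq> {..<npar C} \<and> defset B (npar C) \<phi> \<noteq> {} \<and>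
     (\<forall>p\<in>defset B (npar C) \<phi>. interp_ok B C p \<and> isomorphic (interp B C p) A)"

definition coordinate_map :: "('b list \<Rightarrow> 'a) \<Rightarrow> 'b ring \<Rightarrow> code \<Rightarrow> 'b list \<Rightarrow> 'a ring \<Rightarrow> bool" where
  "coordinate_map f B C p A \<longleftrightarrow>
     interp_ok B C p \<and> f ` code_dom B C p = carrier A \<and>
     (\<exists>h\<in>struct_iso (interp B C p) A. \<forall>x\<in>code_dom B C p. f x = h (code_rel B C p `` {x}))"


section \<open>Composition of codes\<close>

primrec ren_term :: "(nat \<Rightarrow> nat) \<Rightarrow> rterm \<Rightarrow> rterm" where
  "ren_term f (Var i) = Var (f i)"
| "ren_term f Zero = Zero"
| "ren_term f One = One"
| "ren_term f (Add s t) = Add (ren_term f s) (ren_term f t)"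
| "ren_term f (Mul s t) = Mul (ren_term f s) (ren_term f t)"

primrec ren :: "(nat \<Rightarrow> nat) \<Rightarrow> fm \<Rightarrow> fm" where
  "ren f (Eq s t) = Eq (ren_term f s) (ren_term f t)"
| "ren f (Neg F) = Neg (ren f F)"
| "ren f (Conj F G) = Conj (ren f F) (ren f G)"
| "ren f (Ex F) = Ex (ren (case_nat 0 (\<lambda>i. Suc (f i))) F)"

text \<open>
  For a code \<open>D\<close> we translate formulas about \<open>D(S, q)\<close> into formulas about \<open>S\<close>.  A variable of the
  original formula becomes a block of \<open>dim D\<close> variables; a translation relative to \<open>N\<close> blocks is
  evaluated at \<open>x0 @ ... @ x(N-1) @ q\<close>, where \<open>xi\<close> represents the value of the variable \<open>i\<close>.

  \<open>inst D N bs F\<close> substitutes into a component formula \<open>F\<close> of \<open>D\<close> the blocks with the numbers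
  listed in \<open>bs\<close>, and for the parameters the variables after the \<open>N\<close>-th block.
\<close>

definition inst :: "code \<Rightarrow> nat \<Rightarrow> nat list \<Rightarrow> fm \<Rightarrow> fm" where
  "inst D N bs F =
     ren (\<lambda>i. if i < length bs * dim D then (bs ! (i div dim D)) * dim D + i mod dim D
              else N * dim D + (i - length bs * dim D)) F"

text \<open>Existential quantification over \<open>dom_fm D\<close>, with \<open>N\<close> blocks outside the quantifier.\<close>

definition Ex_block :: "code \<Rightarrow> nat \<Rightarrow> fm \<Rightarrow> fm" where
  "Ex_block D N F = (Ex ^^ dim D) (Conj (inst D (Suc N) [0] (dom_fm D)) F)"

text \<open>
  \<open>tr_term D N d t j\<close> says that block \<open>j\<close> represents the value of \<open>t\<close>, where the variable \<open>i\<close> of \<open>t\<close> is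
  represented by block \<open>d + i\<close>.
\<close>

primrec tr_term :: "code \<Rightarrow> nat \<Rightarrow> nat \<Rightarrow> rterm \<Rightarrow> nat \<Rightarrow> fm" where
  "tr_term D N d (Var i) j = inst D N [j, d + i] (eq_fm D)"
| "tr_term D N d Zero j = inst D N [j] (zero_fm D)"
| "tr_term D N d One j = inst D N [j] (one_fm D)"
| "tr_term D N d (Add s t) j =
     Ex_block D N (Ex_block D (N + 1)
       (Conj (Conj (tr_term D (N + 2) (d + 2) s 1) (tr_term D (N + 2) (d + 2) t 0))
             (inst D (N + 2) [1, 0, j + 2] (add_fm D))))"
| "tr_term D N d (Mul s t) j =
     Ex_block D N (Ex_block D (N + 1)
       (Conj (Conj (tr_term D (N + 2) (d + 2) s 1) (tr_term D (N + 2) (d + 2) t 0))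
             (inst D (N + 2) [1, 0, j + 2] (mul_fm D))))"

primrec tr :: "code \<Rightarrow> nat \<Rightarrow> fm \<Rightarrow> fm" where
  "tr D N (Eq s t) = Ex_block D N (Conj (tr_term D (N + 1) 1 s 0) (tr_term D (N + 1) 1 t 0))"
| "tr D N (Neg F) = Neg (tr D N F)"
| "tr D N (Conj F G) = Conj (tr D N F) (tr D N G)"
| "tr D N (Ex F) = Ex_block D N (tr D (N + 1) F)"

definition blocks_in_dom :: "code \<Rightarrow> nat \<Rightarrow> nat \<Rightarrow> fm \<Rightarrow> fm" where
  "blocks_in_dom D N l F = foldr (\<lambda>i. Conj (inst D N [i] (dom_fm D))) [0..<l] F"

text \<open>
  The composite \<open>C \<circ> D\<close>.  Its parameters are \<open>npar C\<close> blocks, representing a parameter tuple of \<open>C\<close> in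
  \<open>D(S, q)\<close>, followed by \<open>q\<close>.  The pair is admissible iff \<open>q\<close> satisfies \<open>\<psi>\<close> and the blocks represent a
  tuple that satisfies \<open>\<phi>\<close> in \<open>D(S, q)\<close>.
\<close>

definition comp_code :: "code \<Rightarrow> code \<Rightarrow> code" where
  "comp_code C D =
     \<lparr>dim = dim C * dim D,
      npar = npar C * dim D + npar D,
      dom_fm = blocks_in_dom D (dim C + npar C) (dim C) (tr D (dim C + npar C) (dom_fm C)),
      eq_fm = tr D (2 * dim C + npar C) (eq_fm C),
      zero_fm = tr D (dim C + npar C) (zero_fm C),
      one_fm = tr D (dim C + npar C) (one_fm C),
      add_fm = tr D (3 * dim C + npar C) (add_fm C),
      mul_fm = tr D (3 * dim C + npar C) (mul_fm C)\<rparr>"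

definition comp_par :: "code \<Rightarrow> fm \<Rightarrow> code \<Rightarrow> fm \<Rightarrow> fm" where
  "comp_par C \<phi> D \<psi> =
     Conj (ren (\<lambda>i. npar C * dim D + i) \<psi>)
          (blocks_in_dom D (npar C) (npar C) (tr D (npar C) \<phi>))"


section \<open>Regular bi-interpretations\<close>

text \<open>
  \<open>\<theta>(u, x, r)\<close> defines, with the parameter \<open>r\<close>, the graph of a coordinate map of \<open>C(A, r)\<close> onto \<open>A\<close>.
\<close>

definition defines_coordinate_map :: "fm \<Rightarrow> 'a ring \<Rightarrow> code \<Rightarrow> 'a list \<Rightarrow> bool" where
  "defines_coordinate_map \<theta> A C r \<longleftrightarrow>
     (\<exists>f. coordinate_map f A C r A \<and>
        {(u, a). u \<in> tuples A (dim C) \<and> a \<in> carrier A \<and> sat A (u @ [a] @ r) \<theta>} =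
        {(u, f u) | u. u \<in> code_dom A C r})"

definition regular_biinterpretation ::
  "code \<Rightarrow> fm \<Rightarrow> code \<Rightarrow> fm \<Rightarrow> fm \<Rightarrow> fm \<Rightarrow> 'a ring \<Rightarrow> 'b ring \<Rightarrow> bool" where
  "regular_biinterpretation C \<phi> D \<psi> \<theta>A \<theta>B A B \<longleftrightarrow>
     regular_interpretation C \<phi> A B \<and> regular_interpretation D \<psi> B A \<and>
     fv \<theta>A \<subseteq> {..<dim (comp_code C D) + 1 + npar (comp_code C D)} \<and>
     fv \<theta>B \<subseteq> {..<dim (comp_code D C) + 1 + npar (comp_code D C)} \<and>
     (\<forall>r\<in>defset A (npar (comp_code C D)) (comp_par C \<phi> D \<psi>).
        defines_coordinate_map \<theta>A A (comp_code C D) r) \<and>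
     (\<forall>r\<in>defset B (npar (comp_code D C)) (comp_par D \<psi> C \<phi>).
        defines_coordinate_map \<theta>B B (comp_code D C) r)"


section \<open>Polynomial and Laurent polynomial rings over the integers\<close>

text \<open>
  A monomial is its finitely supported exponent function; exponents in \<^typ>\<open>nat\<close> give polynomials,
  exponents in \<^typ>\<open>int\<close> give Laurent polynomials.  The indeterminates are numbered \<open>0, ..., k - 1\<close>.
\<close>

definition int_poly_ring :: "nat \<Rightarrow> ((nat \<Rightarrow>\<^sub>0 nat) \<Rightarrow>\<^sub>0 int) ring" where
  "int_poly_ring k =
     \<lparr>carrier = {f. \<forall>m\<in>Poly_Mapping.keys f. Poly_Mapping.keys m \<subseteq> {..<k}},
      mult = (*), one = 1, zero = 0, add = (+)\<rparr>"

definition int_laurent_ring :: "nat \<Rightarrow> ((nat \<Rightarrow>\<^sub>0 int) \<Rightarrow>\<^sub>0 int) ring" where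
  "int_laurent_ring k =
     \<lparr>carrier = {f. \<forall>m\<in>Poly_Mapping.keys f. Poly_Mapping.keys m \<subseteq> {..<k}},
      mult = (*), one = 1, zero = 0, add = (+)\<rparr>"

end

theory Submission
  imports Defs
begin

text \<open>
  Choose an admissible parameter tuple of \<open>\<Gamma> \<circ> \<Delta>\<close> in \<open>R'\<close>, i.e. some \<open>q\<close> satisfying \<open>\<psi>\<close> together with
  representatives of a tuple \<open>p\<close> that satisfies \<open>\<phi>\<close> in \<open>\<Delta>(R', q)\<close>; one exists because one exists in \<open>R\<close>.
  For each sentence true in \<open>\<int>\<close>, the formula saying that it holds in \<open>\<Delta>(_, q)\<close> follows from \<open>\<psi>(q)\<close> in \<open>R\<close>,
  hence in \<open>R'\<close>, so \<open>\<Delta>(R', q) \<equiv> \<int>\<close>.  That \<open>\<theta>\<^sub>R\<close> defines a coordinate map of \<open>\<Gamma> \<circ> \<Delta>\<close> is also first-order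
  in the parameters, so it transfers to \<open>R'\<close> and gives \<open>R' \<cong> \<Gamma>(\<Delta>(R', q), p)\<close>.
\<close>

section \<open>Satisfaction\<close>

text \<open>Elementary equivalence transfers sentences only, while quotient structures, isomorphisms
  and particular parameters are not objects of the language. Hence everything known in
  \<open>R\<close> is put as a formula that holds at every tuple with a given definable property,
  and parameters for \<open>R'\<close> are chosen anew. This is what regularity is for: the
  conditions hold at all admissible parameters and not at one special tuple. Well-definedness comes
  first, because the translation of formulas is shown faithful only for a well-defined
  interpretation. For \<Delta> it passes from \<open>R\<close> to \<open>R'\<close>, and for
  \<Gamma> from \<Z> to \<Delta>(R', q), once these two are known to be elementarily equivalent. An
  isomorphism is replaced by conditions on the relation that \<open>\<theta>\<^sub>R\<close>
  defines. A mismatch remains: \<open>\<theta>\<^sub>R\<close> speaks of the composite code, which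
  lives on long tuples over \<open>R'\<close>, while the structure wanted is an iterated quotient.
  Choosing representatives bridges the two.\<close>

definition closed_struct :: "'a ring \<Rightarrow> bool" where
  "closed_struct S \<longleftrightarrow> \<zero>\<^bsub>S\<^esub> \<in> carrier S \<and> \<one>\<^bsub>S\<^esub> \<in> carrier S \<and>
     (\<forall>x\<in>carrier S. \<forall>y\<in>carrier S. x \<oplus>\<^bsub>S\<^esub> y \<in> carrier S \<and> x \<otimes>\<^bsub>S\<^esub> y \<in> carrier S)"

lemma ring_closed_struct: "ring S \<Longrightarrow> closed_struct S"
  by (simp add: closed_struct_def ring.ring_simprules)

lemma eval_closed:
  assumes "closed_struct S" "set e \<subseteq> carrier S" "fv_term t \<subseteq> {..<length e}"
  shows "eval S e t \<in> carrier S"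
  using assms by (induction t) (auto simp: closed_struct_def subset_iff)

lemma eval_ren:
  "(\<And>i. i \<in> fv_term t \<Longrightarrow> e ! f i = e' ! i) \<Longrightarrow> eval S e (ren_term f t) = eval S e' t"
  by (induction t) auto

lemma sat_ren:
  "(\<And>i. i \<in> fv F \<Longrightarrow> e ! f i = e' ! i) \<Longrightarrow> sat S e (ren f F) = sat S e' F"
proof (induction F arbitrary: e e' f)
  case (Eq s t)
  then show ?case by (simp add: eval_ren[where e' = e'])
next
  case (Ex F)
  have "sat S (a # e) (ren (case_nat 0 (\<lambda>i. Suc (f i))) F) = sat S (a # e') F" for a
    by (rule Ex.IH) (use Ex.prems in \<open>auto split: nat.split\<close>)
  then show ?case by simp
next
  case (Conj F G)
  have "sat S e (ren f F) = sat S e' F" "sat S e (ren f G) = sat S e' G"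
    by (rule Conj.IH, simp add: Conj.prems)+
  then show ?case by simp
next
  case (Neg F)
  have "sat S e (ren f F) = sat S e' F"
    by (rule Neg.IH, simp add: Neg.prems)
  then show ?case by simp
qed

lemma fv_ren_term: "fv_term (ren_term f t) = f ` fv_term t"
  by (induction t) auto

lemma fv_ren: "fv (ren f F) = f ` fv F"
proof (induction F arbitrary: f)
  case (Ex F)
  show ?case
    unfolding ren.simps fv.simps Ex.IH
    by (auto simp: image_iff split: nat.splits intro!: bexI[where x = "Suc _"] dest!: gr0_implies_Suc)
qed (auto simp: fv_ren_term)

section \<open>Tuples and blocks of quantifiers\<close>

lemma tuples_Nil [simp]: "tuples S 0 = {[]}"
  by (auto simp: tuples_def)

lemma tuples_length: "x \<in> tuples S n \<Longrightarrow> length x = n"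
  by (simp add: tuples_def)

lemma tuples_append: "x \<in> tuples S n \<Longrightarrow> y \<in> tuples S m \<Longrightarrow> x @ y \<in> tuples S (n + m)"
  by (simp add: tuples_def)

lemma sat_Ex_pow: "sat S e ((Ex ^^ n) F) \<longleftrightarrow> (\<exists>x\<in>tuples S n. sat S (x @ e) F)"
proof (induction n arbitrary: F)
  case (Suc n)
  \<comment> \<open>The innermost \<open>Ex\<close> is split off, because it is the one that binds
    the head of the tuple.\<close>
  have "sat S e ((Ex ^^ Suc n) F) \<longleftrightarrow> (\<exists>x\<in>tuples S n. \<exists>a\<in>carrier S. sat S (a # x @ e) F)"
    by (simp add: funpow_Suc_right Suc del: funpow.simps)
  also have "\<dots> \<longleftrightarrow> (\<exists>x\<in>tuples S (Suc n). sat S (x @ e) F)"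
    by (fastforce simp: tuples_def length_Suc_conv)
  finally show ?case .
qed simp

lemma fv_Ex_pow: "fv ((Ex ^^ n) F) = {i. i + n \<in> fv F}"
  by (induction n) auto

definition All_n :: "nat \<Rightarrow> fm \<Rightarrow> fm" where "All_n n F = Neg ((Ex ^^ n) (Neg F))"
definition Imp :: "fm \<Rightarrow> fm \<Rightarrow> fm" where "Imp F G = Neg (Conj F (Neg G))"
definition Iff :: "fm \<Rightarrow> fm \<Rightarrow> fm" where "Iff F G = Conj (Imp F G) (Imp G F)"

lemma sat_All_n: "sat S e (All_n n F) \<longleftrightarrow> (\<forall>x\<in>tuples S n. sat S (x @ e) F)"
  by (simp add: All_n_def sat_Ex_pow)

lemma sat_Imp [simp]: "sat S e (Imp F G) \<longleftrightarrow> (sat S e F \<longrightarrow> sat S e G)"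
  by (simp add: Imp_def)

lemma sat_Iff [simp]: "sat S e (Iff F G) \<longleftrightarrow> (sat S e F \<longleftrightarrow> sat S e G)"
  by (auto simp: Iff_def)

lemma fv_All_n [simp]: "fv (All_n n F) = {i. i + n \<in> fv F}"
  by (simp add: All_n_def fv_Ex_pow)

lemma fv_Imp [simp]: "fv (Imp F G) = fv F \<union> fv G"
  by (simp add: Imp_def)

lemma fv_Iff [simp]: "fv (Iff F G) = fv F \<union> fv G"
  by (auto simp: Iff_def)

section \<open>Transfer of formulas along elementary equivalence\<close>

lemma elem_equiv_transfer:
  assumes "elem_equiv S T" "fv F \<subseteq> {..<n}" "\<And>e. e \<in> tuples S n \<Longrightarrow> sat S e F"
    and "e \<in> tuples T n"
  shows "sat T e F"
proof -
  have "fv (All_n n F) = {}" using assms(2) by auto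
  moreover have "sat S [] (All_n n F)" using assms(3) by (simp add: sat_All_n)
  ultimately have "sat T [] (All_n n F)" using assms(1) by (simp add: elem_equiv_def)
  then show ?thesis using assms(4) by (simp add: sat_All_n)
qed

lemma elem_equiv_sym: "elem_equiv S T \<Longrightarrow> elem_equiv T S"
  by (simp add: elem_equiv_def)

text \<open>A parameter tuple cannot be moved from \<open>S\<close> to \<open>T\<close>, but the
  universal closure of the implication from \<open>G\<close> to \<open>F\<close> can. All later
  transfers with parameters take this form, with \<open>G\<close> the admissibility
  condition.\<close>

lemma elem_equiv_transfer_defset:
  assumes "elem_equiv S T" "fv G \<subseteq> {..<n}" "fv F \<subseteq> {..<n}"
    and "\<And>e. e \<in> defset S n G \<Longrightarrow> sat S e F" and "e \<in> defset T n G"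
  shows "sat T e F"
  using elem_equiv_transfer[of S T "Imp G F" n e] assms by (auto simp: defset_def)

lemma elem_equiv_defset_nonempty:
  assumes "elem_equiv S T" "fv G \<subseteq> {..<n}" "defset S n G \<noteq> {}"
  shows "defset T n G \<noteq> {}"
  using elem_equiv_transfer[of T S "Neg G" n] elem_equiv_sym[OF assms(1)] assms(2,3)
  by (auto simp: defset_def)

text \<open>One implication is enough, since it can also be applied to the negation.\<close>

lemma elem_equivI:
  assumes "\<And>F. fv F = {} \<Longrightarrow> sat S [] F \<Longrightarrow> sat T [] F"
  shows "elem_equiv S T"
  unfolding elem_equiv_def
proof (intro allI impI)
  fix F assume "fv F = {}"
  then show "sat S [] F = sat T [] F"
    using assms[of F] assms[of "Neg F"] by auto
qed

section \<open>Invariance under isomorphism\<close>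

lemma struct_iso_eval:
  assumes "h \<in> struct_iso S T" "closed_struct S" "set e \<subseteq> carrier S" "fv_term t \<subseteq> {..<length e}"
  shows "eval T (map h e) t = h (eval S e t)"
  using assms(4)
proof (induction t)
  case (Add s t)
  then show ?case using eval_closed[OF assms(2,3)] assms(1)
    by (simp add: struct_iso_def ring_iso_def ring_hom_def)
next
  case (Mul s t)
  then show ?case using eval_closed[OF assms(2,3)] assms(1)
    by (simp add: struct_iso_def ring_iso_def ring_hom_def)
qed (use assms(1) in \<open>auto simp: struct_iso_def ring_iso_def ring_hom_def\<close>)

text \<open>Equations need \<open>h\<close> to be injective, which it is on the carrier only, so the
  values of terms must lie there; quantifiers need that \<open>h\<close> maps onto the carrier of
  \<open>T\<close>.\<close>

lemma struct_iso_sat: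
  assumes "h \<in> struct_iso S T" "closed_struct S" "set e \<subseteq> carrier S" "fv F \<subseteq> {..<length e}"
  shows "sat T (map h e) F = sat S e F"
  using assms(3,4)
proof (induction F arbitrary: e)
  case (Eq s t)
  have "inj_on h (carrier S)" using assms(1) by (simp add: struct_iso_def ring_iso_def bij_betw_def)
  moreover have "eval S e s \<in> carrier S" "eval S e t \<in> carrier S"
    using Eq eval_closed[OF assms(2)] by auto
  ultimately show ?case using Eq by (simp add: struct_iso_eval[OF assms(1,2)] inj_on_eq_iff)
next
  case (Ex F)
  have *: "carrier T = h ` carrier S"
    using assms(1) by (simp add: struct_iso_def ring_iso_def bij_betw_def)
  have "fv F \<subseteq> {..<Suc (length e)}"
  proof
    fix i assume "i \<in> fv F" then show "i \<in> {..<Suc (length e)}" using Ex.prems(2) by (cases i) auto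
  qed
  then have "sat T (map h (a # e)) F = sat S (a # e) F" if "a \<in> carrier S" for a
    using that Ex.prems(1) by (intro Ex.IH) auto
  then show ?case by (simp add: *)
qed auto

section \<open>Formulas with blocks of variables\<close>

text \<open>An environment is regarded as a concatenation of blocks with lengths \<open>ns\<close>,
  and \<open>F\<close> is to be read at the concatenation of the blocks numbered in
  \<open>is\<close>. The list in the body enumerates the positions of those blocks. In contrast to
  \<open>inst\<close>, the lengths may differ, as they do for tuples, single values and
  parameters.\<close>

definition blk :: "nat list \<Rightarrow> nat list \<Rightarrow> fm \<Rightarrow> fm" where
  "blk ns is F =
     ren (\<lambda>i. concat (map (\<lambda>j. [sum_list (take j ns)..<sum_list (take (Suc j) ns)]) is) ! i) F"

text \<open>With the environment kept as a list of blocks, a quantifier over tuples acts as a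
  \<open>Cons\<close> and block numbers are plain list indices.\<close>

definition satb :: "'a ring \<Rightarrow> 'a list list \<Rightarrow> fm \<Rightarrow> bool" where
  "satb S xs F = sat S (concat xs) F"

lemma satb_simps [simp]:
  "satb S xs (Neg F) \<longleftrightarrow> \<not> satb S xs F"
  "satb S xs (Conj F G) \<longleftrightarrow> satb S xs F \<and> satb S xs G"
  "satb S xs (Imp F G) \<longleftrightarrow> (satb S xs F \<longrightarrow> satb S xs G)"
  "satb S xs (Iff F G) \<longleftrightarrow> (satb S xs F \<longleftrightarrow> satb S xs G)"
  "satb S xs ((Ex ^^ n) F) \<longleftrightarrow> (\<exists>x\<in>tuples S n. satb S (x # xs) F)"
  "satb S xs (All_n n F) \<longleftrightarrow> (\<forall>x\<in>tuples S n. satb S (x # xs) F)"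
  by (simp_all add: satb_def sat_Ex_pow sat_All_n)

lemma sum_list_take_mono: "j \<le> k \<Longrightarrow> sum_list (take j ns) \<le> sum_list (take k (ns :: nat list))"
  by (metis le_add1 le_iff_add sum_list_append take_add)

lemma map_nth_concat:
  "j < length xs \<Longrightarrow>
    map ((!) (concat xs)) [sum_list (take j (map length xs))..<sum_list (take (Suc j) (map length xs))]
      = xs ! j"
proof (induction xs arbitrary: j)
  case (Cons x xs)
  show ?case
  proof (cases j)
    case 0
    then show ?thesis by (auto intro!: nth_equalityI simp: nth_append)
  next
    case (Suc k)
    have "map ((!) (concat (x # xs))) [length x + a..<length x + b] = map ((!) (concat xs)) [a..<b]" for a b
      by (rule nth_equalityI) (auto simp: nth_append)
    then show ?thesis using Suc Cons by simp
  qed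
qed simp

lemma satb_blk:
  assumes "ns = map length xs" "\<forall>j\<in>set is. j < length xs" "fv F \<subseteq> {..<sum_list (map ((!) ns) is)}"
  shows "satb S xs (blk ns is F) = sat S (concat (map ((!) xs) is)) F"
proof -
  define L where "L = concat (map (\<lambda>j. [sum_list (take j ns)..<sum_list (take (Suc j) ns)]) is)"
  have m: "map ((!) (concat xs)) L = concat (map ((!) xs) is)"
    unfolding L_def map_concat using map_nth_concat[of _ xs] assms(1,2) by (simp cong: map_cong)
  then have "length L = length (concat (map ((!) xs) is))" by (metis length_map)
  also have "\<dots> = sum_list (map ((!) ns) is)"
    using assms(1,2) by (simp add: length_concat comp_def cong: map_cong)
  finally have len: "length L = sum_list (map ((!) ns) is)" .
  show ?thesis
    unfolding satb_def blk_def L_def[symmetric]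
    by (rule sat_ren) (metis assms(3) len lessThan_iff m nth_map subsetD)
qed

lemma fv_blk:
  assumes "\<forall>j\<in>set is. j < length ns" "fv F \<subseteq> {..<sum_list (map ((!) ns) is)}"
  shows "fv (blk ns is F) \<subseteq> {..<sum_list ns}"
proof -
  define L where "L = concat (map (\<lambda>j. [sum_list (take j ns)..<sum_list (take (Suc j) ns)]) is)"
  have "length L = sum_list (map ((!) ns) is)"
    unfolding L_def using assms(1) by (simp add: length_concat comp_def take_Suc_conv_app_nth cong: map_cong)
  moreover have "set L \<subseteq> {..<sum_list ns}"
  proof
    fix i assume "i \<in> set L"
    then obtain j where "j \<in> set is" "i < sum_list (take (Suc j) ns)"
      by (auto simp: L_def)
    moreover from this have "sum_list (take (Suc j) ns) \<le> sum_list ns"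
      using sum_list_take_mono[of "Suc j" "length ns" ns] assms(1) by (simp add: Suc_le_eq)
    ultimately show "i \<in> {..<sum_list ns}" by simp
  qed
  ultimately show ?thesis
    unfolding blk_def L_def[symmetric] fv_ren image_subset_iff using assms(2)
    by (metis lessThan_iff nth_mem subsetD)
qed


section \<open>Interpreted structures\<close>

abbreviation cls :: "'a ring \<Rightarrow> code \<Rightarrow> 'a list \<Rightarrow> 'a list \<Rightarrow> 'a list set" where
  "cls S C p x \<equiv> code_rel S C p `` {x}"

lemma code_dom_tuples: "x \<in> code_dom S C p \<Longrightarrow> x \<in> tuples S (dim C)"
  by (simp add: code_dom_def)

lemma code_dom_length: "x \<in> code_dom S C p \<Longrightarrow> length x = dim C"
  by (simp add: code_dom_def tuples_def)

lemma cls_in_carrier: "x \<in> code_dom S C p \<Longrightarrow> cls S C p x \<in> carrier (interp S C p)"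
  by (simp add: interp_def quotientI)

lemma carrier_interpE:
  assumes "c \<in> carrier (interp S C p)"
  obtains x where "x \<in> code_dom S C p" "c = cls S C p x"
  using assms by (auto simp: interp_def elim: quotientE)

lemma cls_eq_iff:
  assumes "interp_ok S C p" "x \<in> code_dom S C p" "y \<in> code_dom S C p"
  shows "cls S C p x = cls S C p y \<longleftrightarrow> sat S (x @ y @ p) (eq_fm C)"
proof -
  have "equiv (code_dom S C p) (code_rel S C p)" using assms(1) by (simp add: interp_ok_def)
  then have "cls S C p x = cls S C p y \<longleftrightarrow> (x, y) \<in> code_rel S C p"
    using assms(2,3) by (rule eq_equiv_class_iff)
  then show ?thesis using assms(2,3) by (simp add: code_rel_def)
qed

text \<open>The constants of \<open>interp\<close>, and the values of its operations on classes, are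
  sets of solutions of a formula. This turns an equation with such a set into the formula itself, at
  a representative.\<close>

lemma class_eq_iff_mem:
  assumes "equiv A E" "c \<in> A // E" "x \<in> A"
  shows "E `` {x} = c \<longleftrightarrow> x \<in> c"
  using assms by (metis equiv_class_self equiv_class_eq_iff Image_singleton_iff quotientE)

text \<open>\<open>op_of\<close> lets the representatives of both arguments vary; the congruence
  half of \<open>defines_op\<close> reduces it to a fixed pair.\<close>

lemma op_of_cls:
  assumes "equiv (code_dom S C p) (code_rel S C p)" "defines_op S C p F"
    and x: "x \<in> code_dom S C p" and y: "y \<in> code_dom S C p"
  shows "op_of S C p F (cls S C p x) (cls S C p y) = {z \<in> code_dom S C p. sat S (x @ y @ z @ p) F}"
proof -
  have refl: "(z, z) \<in> code_rel S C p" if "z \<in> code_dom S C p" for z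
    using assms(1) that by (simp add: equiv_def refl_on_def)
  have "sat S (x @ y @ z @ p) F"
    if "z \<in> code_dom S C p" "x' \<in> cls S C p x" "y' \<in> cls S C p y" "sat S (x' @ y' @ z @ p) F" for x' y' z
    using assms(2) that refl[OF that(1)] unfolding defines_op_def Image_singleton_iff by blast
  then show ?thesis
    unfolding op_of_def using refl[OF x] refl[OF y] by blast
qed

lemma interp_op:
  assumes "equiv (code_dom S C p) (code_rel S C p)" "defines_op S C p F"
    and "x \<in> code_dom S C p" "y \<in> code_dom S C p"
  shows "op_of S C p F (cls S C p x) (cls S C p y) \<in> code_dom S C p // code_rel S C p"
    and "z \<in> code_dom S C p \<Longrightarrow>
      op_of S C p F (cls S C p x) (cls S C p y) = cls S C p z \<longleftrightarrow> sat S (x @ y @ z @ p) F"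
proof -
  show *: "op_of S C p F (cls S C p x) (cls S C p y) \<in> code_dom S C p // code_rel S C p"
    unfolding op_of_cls[OF assms] using assms(2-4) by (simp add: defines_op_def)
  show "op_of S C p F (cls S C p x) (cls S C p y) = cls S C p z \<longleftrightarrow> sat S (x @ y @ z @ p) F"
    if "z \<in> code_dom S C p"
    using class_eq_iff_mem[OF assms(1) * that] that unfolding op_of_cls[OF assms] by auto
qed

text \<open>Together with \<open>cls_eq_iff\<close> this is the dictionary between equations of
  classes and formulas at representatives. The translation and the coordinate maps access the
  operations through it.\<close>

lemma interp_ok_ops:
  assumes "interp_ok S C p" "x \<in> code_dom S C p"
  shows "cls S C p x = \<zero>\<^bsub>interp S C p\<^esub> \<longleftrightarrow> sat S (x @ p) (zero_fm C)"
    and "cls S C p x = \<one>\<^bsub>interp S C p\<^esub> \<longleftrightarrow> sat S (x @ p) (one_fm C)"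
    and "y \<in> code_dom S C p \<Longrightarrow> z \<in> code_dom S C p \<Longrightarrow>
      cls S C p x \<oplus>\<^bsub>interp S C p\<^esub> cls S C p y = cls S C p z \<longleftrightarrow> sat S (x @ y @ z @ p) (add_fm C)"
    and "y \<in> code_dom S C p \<Longrightarrow> z \<in> code_dom S C p \<Longrightarrow>
      cls S C p x \<otimes>\<^bsub>interp S C p\<^esub> cls S C p y = cls S C p z \<longleftrightarrow> sat S (x @ y @ z @ p) (mul_fm C)"
proof -
  have e: "equiv (code_dom S C p) (code_rel S C p)" using assms(1) by (simp add: interp_ok_def)
  show "cls S C p x = \<zero>\<^bsub>interp S C p\<^esub> \<longleftrightarrow> sat S (x @ p) (zero_fm C)"
    using class_eq_iff_mem[OF e _ assms(2)] assms by (simp add: interp_ok_def interp_def)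
  show "cls S C p x = \<one>\<^bsub>interp S C p\<^esub> \<longleftrightarrow> sat S (x @ p) (one_fm C)"
    using class_eq_iff_mem[OF e _ assms(2)] assms by (simp add: interp_ok_def interp_def)
  show "y \<in> code_dom S C p \<Longrightarrow> z \<in> code_dom S C p \<Longrightarrow>
      cls S C p x \<oplus>\<^bsub>interp S C p\<^esub> cls S C p y = cls S C p z \<longleftrightarrow> sat S (x @ y @ z @ p) (add_fm C)"
    using interp_op(2)[OF e] assms by (simp add: interp_ok_def interp_def)
  show "y \<in> code_dom S C p \<Longrightarrow> z \<in> code_dom S C p \<Longrightarrow>
      cls S C p x \<otimes>\<^bsub>interp S C p\<^esub> cls S C p y = cls S C p z \<longleftrightarrow> sat S (x @ y @ z @ p) (mul_fm C)"
    using interp_op(2)[OF e] assms by (simp add: interp_ok_def interp_def)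
qed

lemma interp_ok_closed_struct:
  assumes "interp_ok S C p"
  shows "closed_struct (interp S C p)"
proof -
  have e: "equiv (code_dom S C p) (code_rel S C p)" using assms by (simp add: interp_ok_def)
  have "op_of S C p F c d \<in> carrier (interp S C p)"
    if "defines_op S C p F" "c \<in> carrier (interp S C p)" "d \<in> carrier (interp S C p)" for F c d
    using that(2,3) interp_op(1)[OF e that(1)]
    by (elim carrier_interpE) (simp add: interp_def)
  from this[of "add_fm C"] this[of "mul_fm C"] show ?thesis
    using assms unfolding closed_struct_def interp_ok_def by (simp add: interp_def)
qed

text \<open>A map \<open>g\<close> with these properties induces a bijection from the quotient onto
  \<open>T\<close>. Its inverse is built, by picking preimages under \<open>g\<close>; the condition
  on \<open>eq_fm\<close> makes the class of the preimage independent of the pick.\<close>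

lemma isomorphic_interpI:
  assumes T: "closed_struct T" and ok: "interp_ok S C p"
    and onto: "g ` code_dom S C p = carrier T"
    and eq: "\<And>x y. x \<in> code_dom S C p \<Longrightarrow> y \<in> code_dom S C p \<Longrightarrow>
      g x = g y \<longleftrightarrow> sat S (x @ y @ p) (eq_fm C)"
    and zero: "\<And>x. x \<in> code_dom S C p \<Longrightarrow> g x = \<zero>\<^bsub>T\<^esub> \<longleftrightarrow> sat S (x @ p) (zero_fm C)"
    and one: "\<And>x. x \<in> code_dom S C p \<Longrightarrow> g x = \<one>\<^bsub>T\<^esub> \<longleftrightarrow> sat S (x @ p) (one_fm C)"
    and add: "\<And>x y z. x \<in> code_dom S C p \<Longrightarrow> y \<in> code_dom S C p \<Longrightarrow> z \<in> code_dom S C p \<Longrightarrow>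
      g x \<oplus>\<^bsub>T\<^esub> g y = g z \<longleftrightarrow> sat S (x @ y @ z @ p) (add_fm C)"
    and mul: "\<And>x y z. x \<in> code_dom S C p \<Longrightarrow> y \<in> code_dom S C p \<Longrightarrow> z \<in> code_dom S C p \<Longrightarrow>
      g x \<otimes>\<^bsub>T\<^esub> g y = g z \<longleftrightarrow> sat S (x @ y @ z @ p) (mul_fm C)"
  shows "isomorphic T (interp S C p)"
proof -
  define h where "h t = cls S C p (SOME x. x \<in> code_dom S C p \<and> g x = t)" for t
  have gx: "g x \<in> carrier T" if "x \<in> code_dom S C p" for x using that onto by auto
  have hg: "h (g x) = cls S C p x" if x: "x \<in> code_dom S C p" for x
  proof -
    define y where "y = (SOME y. y \<in> code_dom S C p \<and> g y = g x)"
    have "y \<in> code_dom S C p \<and> g y = g x"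
      unfolding y_def by (rule someI[of _ x]) (use x in simp)
    then show ?thesis
      unfolding h_def y_def[symmetric] using x cls_eq_iff[OF ok] eq by blast
  qed
  have ex: "\<exists>x\<in>code_dom S C p. t = g x" if "t \<in> carrier T" for t using that onto by auto
  have cl: "t \<oplus>\<^bsub>T\<^esub> u \<in> carrier T" "t \<otimes>\<^bsub>T\<^esub> u \<in> carrier T"
    if "t \<in> carrier T" "u \<in> carrier T" for t u
    using T that by (auto simp: closed_struct_def)
  have 0: "\<zero>\<^bsub>T\<^esub> \<in> carrier T" "\<one>\<^bsub>T\<^esub> \<in> carrier T" using T by (auto simp: closed_struct_def)
  have "bij_betw h (carrier T) (carrier (interp S C p))"
    unfolding bij_betw_def
  proof
    show "inj_on h (carrier T)"
      by (auto simp: inj_on_def onto[symmetric] hg cls_eq_iff[OF ok] eq)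
    show "h ` carrier T = carrier (interp S C p)"
      by (auto simp: onto[symmetric] image_image hg cls_in_carrier elim!: carrier_interpE cong: image_cong)
  qed
  moreover have "h \<in> ring_hom T (interp S C p)"
  proof (rule ring_hom_memI)
    fix t assume "t \<in> carrier T" then show "h t \<in> carrier (interp S C p)"
      using ex hg cls_in_carrier by metis
  next
    fix t u assume tu: "t \<in> carrier T" "u \<in> carrier T"
    \<comment> \<open>The formulas describe graphs, so the sum and the product must be values of
      \<open>g\<close> as well; closure of \<open>T\<close> and surjectivity of \<open>g\<close>
      provide this.\<close>
    then obtain x y z w where *: "x \<in> code_dom S C p" "y \<in> code_dom S C p" "z \<in> code_dom S C p"
      "w \<in> code_dom S C p" "t = g x" "u = g y" "t \<oplus>\<^bsub>T\<^esub> u = g z" "t \<otimes>\<^bsub>T\<^esub> u = g w"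
      using ex cl by metis
    show "h (t \<oplus>\<^bsub>T\<^esub> u) = h t \<oplus>\<^bsub>interp S C p\<^esub> h u"
      unfolding *(7) using *(1-3,5-7) add hg interp_ok_ops(3)[OF ok *(1,2,3)] by metis
    show "h (t \<otimes>\<^bsub>T\<^esub> u) = h t \<otimes>\<^bsub>interp S C p\<^esub> h u"
      unfolding *(8) using *(1,2,4,5,6,8) mul hg interp_ok_ops(4)[OF ok *(1,2,4)] by metis
  next
    show "h \<one>\<^bsub>T\<^esub> = \<one>\<^bsub>interp S C p\<^esub>"
      using ex[OF 0(2)] one hg interp_ok_ops(2)[OF ok] by metis
  qed
  moreover have "h \<zero>\<^bsub>T\<^esub> = \<zero>\<^bsub>interp S C p\<^esub>"
    using ex[OF 0(1)] zero hg interp_ok_ops(1)[OF ok] by metis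
  ultimately show ?thesis
    by (auto simp: isomorphic_def struct_iso_def ring_iso_def)
qed

section \<open>Correctness of the translation\<close>

lemma block_index_less:
  assumes "j < N" "k < d"
  shows "j * d + k < N * (d :: nat)"
proof -
  have "Suc j * d \<le> N * d" using assms(1) by (intro mult_le_mono1) simp
  then show ?thesis using assms(2) by simp
qed

lemma nth_concat_uniform:
  assumes "\<forall>x\<in>set xs. length x = d" "j < length xs" "k < d"
  shows "concat xs ! (j * d + k) = xs ! j ! k"
  using assms
proof (induction xs arbitrary: j)
  case (Cons x xs)
  then show ?case by (cases j) (auto simp: nth_append)
qed simp

lemma length_concat_uniform:
  "\<forall>x\<in>set xs. length x = d \<Longrightarrow> length (concat xs) = length xs * d"
  by (induction xs) auto

lemma sat_inst:
  assumes xs: "\<forall>x\<in>set xs. length x = dim D" "N = length xs" and bs: "\<forall>j\<in>set bs. j < N"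
    and "fv F \<subseteq> {..<length bs * dim D + npar D}" "length q = npar D"
  shows "sat S (concat xs @ q) (inst D N bs F) = sat S (concat (map ((!) xs) bs) @ q) F"
  unfolding inst_def
proof (rule sat_ren)
  fix i assume "i \<in> fv F"
  have u: "\<forall>x\<in>set (map ((!) xs) bs). length x = dim D" using xs bs by auto
  note lc = length_concat_uniform[OF xs(1)] length_concat_uniform[OF u]
  show "(concat xs @ q) ! (if i < length bs * dim D then bs ! (i div dim D) * dim D + i mod dim D
          else N * dim D + (i - length bs * dim D)) = (concat (map ((!) xs) bs) @ q) ! i"
  proof (cases "i < length bs * dim D")
    case True
    \<comment> \<open>A code may have dimension 0, but then no index falls into this case, so
      \<open>div\<close> and \<open>mod\<close> are never taken by 0.\<close>
    then have d: "dim D > 0" by (cases "dim D") auto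
    have k: "i div dim D < length bs" using True by (simp add: less_mult_imp_div_less)
    then have j: "bs ! (i div dim D) < length xs" using bs xs(2) by auto
    have m: "i mod dim D < dim D" using d by simp
    have "bs ! (i div dim D) * dim D + i mod dim D < length xs * dim D"
      using j m by (rule block_index_less)
    moreover have "concat (map ((!) xs) bs) ! i = concat (map ((!) xs) bs) ! ((i div dim D) * dim D + i mod dim D)"
      by simp
    ultimately show ?thesis
      using True nth_concat_uniform[OF xs(1) j m] nth_concat_uniform[OF u _ m, of "i div dim D"] k
      by (simp add: nth_append lc)
  next
    case False
    then have "\<not> length xs * dim D + i - length bs * dim D < length xs * dim D" by linarith
    then show ?thesis using False lc xs(2) by (simp add: nth_append)
  qed
qed

lemma fv_inst:
  assumes "\<forall>j\<in>set bs. j < N" "fv F \<subseteq> {..<length bs * dim D + npar D}"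
  shows "fv (inst D N bs F) \<subseteq> {..<N * dim D + npar D}"
proof -
  have "bs ! (i div dim D) * dim D + i mod dim D < N * dim D" if "i < length bs * dim D" for i
  proof -
    have d: "dim D > 0" using that by (cases "dim D") auto
    show ?thesis
      using assms(1) that d by (intro block_index_less) (simp_all add: less_mult_imp_div_less)
  qed
  then show ?thesis
    unfolding inst_def fv_ren using assms(2) by (fastforce intro: trans_less_add1)
qed

lemma is_code_bounds:
  assumes "is_code C"
  shows "fv (dom_fm C) \<subseteq> {..<dim C + npar C}" "fv (eq_fm C) \<subseteq> {..<2 * dim C + npar C}"
    "fv (zero_fm C) \<subseteq> {..<dim C + npar C}" "fv (one_fm C) \<subseteq> {..<dim C + npar C}"
    "fv (add_fm C) \<subseteq> {..<3 * dim C + npar C}" "fv (mul_fm C) \<subseteq> {..<3 * dim C + npar C}"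
  using assms by (simp_all add: is_code_def)

lemma sat_Ex_block:
  assumes "is_code D" "length q = npar D" "\<forall>x\<in>set xs. length x = dim D" "N = length xs"
  shows "sat S (concat xs @ q) (Ex_block D N F) \<longleftrightarrow>
    (\<exists>x\<in>code_dom S D q. sat S (concat (x # xs) @ q) F)"
proof -
  have "sat S (concat (x # xs) @ q) (inst D (Suc N) [0] (dom_fm D)) = sat S (x @ q) (dom_fm D)"
    if "x \<in> tuples S (dim D)" for x
    using that assms is_code_bounds(1)[OF assms(1)] by (subst sat_inst) (auto simp: tuples_def)
  then show ?thesis by (auto simp: Ex_block_def sat_Ex_pow code_dom_def)
qed

lemma fv_Ex_block:
  assumes "is_code D" "fv F \<subseteq> {..<(N + 1) * dim D + npar D}"
  shows "fv (Ex_block D N F) \<subseteq> {..<N * dim D + npar D}"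
proof -
  have "fv (inst D (Suc N) [0] (dom_fm D)) \<subseteq> {..<Suc N * dim D + npar D}"
    using is_code_bounds(1)[OF assms(1)] by (intro fv_inst) auto
  then show ?thesis using assms(2) by (fastforce simp: Ex_block_def fv_Ex_pow)
qed

text \<open>The step shared by sums and products, with \<open>A\<close> and \<open>B\<close> in the
  role of the translated arguments. Behind the two quantifiers \<open>y\<close> is block 0,
  \<open>x\<close> is block 1 and the old block \<open>j\<close> has number \<open>j + 2\<close>.
  Witnesses exist because \<open>a\<close> and \<open>b\<close> are classes.\<close>

lemma sat_tr_op:
  assumes D: "is_code D" "interp_ok S D q" "length q = npar D"
    and xs: "set xs \<subseteq> code_dom S D q" "N = length xs" "j < N"
    and F: "fv F \<subseteq> {..<3 * dim D + npar D}"
    and op: "\<And>x y z. x \<in> code_dom S D q \<Longrightarrow> y \<in> code_dom S D q \<Longrightarrow> z \<in> code_dom S D q \<Longrightarrow>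
      f (cls S D q x) (cls S D q y) = cls S D q z \<longleftrightarrow> sat S (x @ y @ z @ q) F"
    and ab: "a \<in> carrier (interp S D q)" "b \<in> carrier (interp S D q)"
    and A: "\<And>x y. x \<in> code_dom S D q \<Longrightarrow> y \<in> code_dom S D q \<Longrightarrow>
      sat S (concat (y # x # xs) @ q) A \<longleftrightarrow> cls S D q x = a"
    and B: "\<And>x y. x \<in> code_dom S D q \<Longrightarrow> y \<in> code_dom S D q \<Longrightarrow>
      sat S (concat (y # x # xs) @ q) B \<longleftrightarrow> cls S D q y = b"
  shows "sat S (concat xs @ q) (Ex_block D N (Ex_block D (N + 1)
      (Conj (Conj A B) (inst D (N + 2) [1, 0, j + 2] F)))) \<longleftrightarrow> cls S D q (xs ! j) = f a b"
proof -
  let ?G = "Conj (Conj A B) (inst D (N + 2) [1, 0, j + 2] F)" and ?c = "cls S D q"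
  have len: "\<forall>x\<in>set xs. length x = dim D" using xs(1) code_dom_length by blast
  have j: "xs ! j \<in> code_dom S D q" using xs by auto
  have "sat S (concat (y # x # xs) @ q) ?G \<longleftrightarrow>
    ?c x = a \<and> ?c y = b \<and> ?c (xs ! j) = f (?c x) (?c y)"
    if "x \<in> code_dom S D q" "y \<in> code_dom S D q" for x y
  proof -
    have "sat S (concat (y # x # xs) @ q) (inst D (N + 2) [1, 0, j + 2] F) =
      sat S (x @ y @ xs ! j @ q) F"
      using len that[THEN code_dom_length] F D(3) xs(2,3) by (subst sat_inst) auto
    then show ?thesis using A[OF that] B[OF that] op[OF that j] by auto
  qed
  moreover have "sat S (concat (x # xs) @ q) (Ex_block D (N + 1) ?G) \<longleftrightarrow>
    (\<exists>y\<in>code_dom S D q. sat S (concat (y # x # xs) @ q) ?G)" if "x \<in> code_dom S D q" for x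
    using len code_dom_length[OF that] xs(2) by (intro sat_Ex_block[OF D(1,3)]) auto
  ultimately have "sat S (concat xs @ q) (Ex_block D N (Ex_block D (N + 1) ?G)) \<longleftrightarrow>
    (\<exists>x\<in>code_dom S D q. \<exists>y\<in>code_dom S D q. ?c x = a \<and> ?c y = b \<and> ?c (xs ! j) = f (?c x) (?c y))"
    by (simp only: sat_Ex_block[OF D(1,3) len xs(2)] cong: bex_cong)
  then show ?thesis using ab by (elim carrier_interpE) auto
qed

text \<open>The first \<open>d\<close> blocks hold auxiliary values introduced by the enclosing
  formula, so the variables of \<open>t\<close> start at block \<open>d\<close>. Each operation puts
  two more blocks in front, which is why the induction varies \<open>xs\<close>, \<open>d\<close>,
  \<open>j\<close> and \<open>N\<close>.\<close>

lemma sat_tr_term: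
  assumes D: "is_code D" "interp_ok S D q" "length q = npar D"
  shows "set xs \<subseteq> code_dom S D q \<Longrightarrow> N = length xs \<Longrightarrow> j < N \<Longrightarrow> \<forall>i\<in>fv_term t. d + i < N \<Longrightarrow>
    sat S (concat xs @ q) (tr_term D N d t j) \<longleftrightarrow>
    cls S D q (xs ! j) = eval (interp S D q) (map (cls S D q) (drop d xs)) t"
proof (induction t arbitrary: xs d j N)
  note [simp] = code_dom_length
  case (Var i)
  then have "xs ! j \<in> code_dom S D q" "xs ! (d + i) \<in> code_dom S D q" by auto
  then show ?case using Var is_code_bounds(2)[OF D(1)] D(3)
    by (simp, subst sat_inst) (auto simp: cls_eq_iff[OF D(2)])
next
  note [simp] = code_dom_length
  case Zero
  then have "xs ! j \<in> code_dom S D q" by auto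
  then show ?case using Zero is_code_bounds(3)[OF D(1)] D(3)
    by (simp, subst sat_inst) (auto simp: interp_ok_ops[OF D(2)])
next
  note [simp] = code_dom_length
  case One
  then have "xs ! j \<in> code_dom S D q" by auto
  then show ?case using One is_code_bounds(4)[OF D(1)] D(3)
    by (simp, subst sat_inst) (auto simp: interp_ok_ops[OF D(2)])
next
  case (Add s t)
  have sub: "set (map (cls S D q) (drop d xs)) \<subseteq> carrier (interp S D q)"
    using Add.prems(1) by (auto intro!: cls_in_carrier dest!: in_set_dropD)
  have cl: "eval (interp S D q) (map (cls S D q) (drop d xs)) u \<in> carrier (interp S D q)"
    if "\<forall>i\<in>fv_term u. d + i < N" for u
    by (rule eval_closed[OF interp_ok_closed_struct[OF D(2)] sub]) (use that Add.prems in force)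
  have A: "sat S (concat (y # x # xs) @ q) (tr_term D (N + 2) (d + 2) s 1) \<longleftrightarrow>
      cls S D q x = eval (interp S D q) (map (cls S D q) (drop d xs)) s"
    if "x \<in> code_dom S D q" "y \<in> code_dom S D q" for x y
    using that Add.prems by (subst Add.IH(1)) auto
  have B: "sat S (concat (y # x # xs) @ q) (tr_term D (N + 2) (d + 2) t 0) \<longleftrightarrow>
      cls S D q y = eval (interp S D q) (map (cls S D q) (drop d xs)) t"
    if "x \<in> code_dom S D q" "y \<in> code_dom S D q" for x y
    using that Add.prems by (subst Add.IH(2)) auto
  show ?case unfolding tr_term.simps eval.simps
    by (rule sat_tr_op[OF D Add.prems(1-3) is_code_bounds(5)[OF D(1)] interp_ok_ops(3)[OF D(2)]])
      (use cl Add.prems(4) A B in simp_all)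
next
  case (Mul s t)
  have sub: "set (map (cls S D q) (drop d xs)) \<subseteq> carrier (interp S D q)"
    using Mul.prems(1) by (auto intro!: cls_in_carrier dest!: in_set_dropD)
  have cl: "eval (interp S D q) (map (cls S D q) (drop d xs)) u \<in> carrier (interp S D q)"
    if "\<forall>i\<in>fv_term u. d + i < N" for u
    by (rule eval_closed[OF interp_ok_closed_struct[OF D(2)] sub]) (use that Mul.prems in force)
  have A: "sat S (concat (y # x # xs) @ q) (tr_term D (N + 2) (d + 2) s 1) \<longleftrightarrow>
      cls S D q x = eval (interp S D q) (map (cls S D q) (drop d xs)) s"
    if "x \<in> code_dom S D q" "y \<in> code_dom S D q" for x y
    using that Mul.prems by (subst Mul.IH(1)) auto
  have B: "sat S (concat (y # x # xs) @ q) (tr_term D (N + 2) (d + 2) t 0) \<longleftrightarrow>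
      cls S D q y = eval (interp S D q) (map (cls S D q) (drop d xs)) t"
    if "x \<in> code_dom S D q" "y \<in> code_dom S D q" for x y
    using that Mul.prems by (subst Mul.IH(2)) auto
  show ?case unfolding tr_term.simps eval.simps
    by (rule sat_tr_op[OF D Mul.prems(1-3) is_code_bounds(6)[OF D(1)] interp_ok_ops(4)[OF D(2)]])
      (use cl Mul.prems(4) A B in simp_all)
qed

text \<open>Every element of the interpreted structure is a class, so quantifying over elements is
  quantifying over representatives. Through this lemma, truth in D(S, q) becomes a property of
  \<open>q\<close> expressible in \<open>S\<close>.\<close>

lemma sat_tr:
  assumes D: "is_code D" "interp_ok S D q" "length q = npar D"
  shows "set xs \<subseteq> code_dom S D q \<Longrightarrow> fv F \<subseteq> {..<N} \<Longrightarrow> N = length xs \<Longrightarrow>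
    sat S (concat xs @ q) (tr D N F) \<longleftrightarrow> sat (interp S D q) (map (cls S D q) xs) F"
proof (induction F arbitrary: xs N)
  case (Eq s t)
  let ?I = "interp S D q" and ?c = "cls S D q"
  have len: "\<forall>x\<in>set xs. length x = dim D" using Eq.prems(1) code_dom_length by blast
  have "sat S (concat xs @ q) (tr D N (Eq s t)) \<longleftrightarrow> (\<exists>x\<in>code_dom S D q.
    ?c x = eval ?I (map ?c xs) s \<and> ?c x = eval ?I (map ?c xs) t)"
    unfolding tr.simps sat_Ex_block[OF D(1,3) len Eq.prems(3)]
  proof (intro bex_cong refl)
    fix x assume x: "x \<in> code_dom S D q"
    have "sat S (concat (x # xs) @ q) (tr_term D (N + 1) 1 u 0) \<longleftrightarrow> ?c x = eval ?I (map ?c xs) u"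
      if "fv_term u \<subseteq> {..<N}" for u
      using x Eq.prems that by (subst sat_tr_term[OF D]) auto
    then show "sat S (concat (x # xs) @ q) (Conj (tr_term D (N + 1) 1 s 0) (tr_term D (N + 1) 1 t 0)) \<longleftrightarrow>
      ?c x = eval ?I (map ?c xs) s \<and> ?c x = eval ?I (map ?c xs) t"
      using Eq.prems by simp
  qed
  \<comment> \<open>The translated equation asks for a block that represents both values. If the
    values agree, such a block exists, because the common value is a class.\<close>
  moreover have "eval ?I (map ?c xs) s \<in> carrier ?I"
    by (rule eval_closed[OF interp_ok_closed_struct[OF D(2)]])
      (use Eq.prems in \<open>auto intro!: cls_in_carrier\<close>)
  ultimately show ?case by (auto elim!: carrier_interpE)
next
  case (Ex F)
  let ?I = "interp S D q" and ?c = "cls S D q"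
  have len: "\<forall>x\<in>set xs. length x = dim D" using Ex.prems(1) code_dom_length by blast
  have "fv F \<subseteq> {..<N + 1}"
  proof
    fix i assume "i \<in> fv F" then show "i \<in> {..<N + 1}" using Ex.prems(2) by (cases i) auto
  qed
  then have "sat S (concat (x # xs) @ q) (tr D (N + 1) F) \<longleftrightarrow> sat ?I (?c x # map ?c xs) F"
    if "x \<in> code_dom S D q" for x
    using that Ex.prems by (subst Ex.IH) auto
  then have "sat S (concat xs @ q) (tr D N (Ex F)) \<longleftrightarrow>
    (\<exists>x\<in>code_dom S D q. sat ?I (?c x # map ?c xs) F)"
    unfolding tr.simps sat_Ex_block[OF D(1,3) len Ex.prems(3)] by (intro bex_cong refl)
  then show ?case by (auto elim!: carrier_interpE intro: cls_in_carrier)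
qed auto

lemma fv_tr_term:
  assumes D: "is_code D"
  shows "j < N \<Longrightarrow> \<forall>i\<in>fv_term t. d + i < N \<Longrightarrow> fv (tr_term D N d t j) \<subseteq> {..<N * dim D + npar D}"
proof (induction t arbitrary: N d j)
  case (Add s t)
  have "fv (tr_term D (N + 2) (d + 2) s 1) \<subseteq> {..<(N + 2) * dim D + npar D}"
    "fv (tr_term D (N + 2) (d + 2) t 0) \<subseteq> {..<(N + 2) * dim D + npar D}"
    using Add.prems by (intro Add.IH; simp)+
  moreover have "fv (inst D (N + 2) [1, 0, j + 2] (add_fm D)) \<subseteq> {..<(N + 2) * dim D + npar D}"
    using Add.prems is_code_bounds(5)[OF D] by (intro fv_inst) auto
  ultimately show ?case
    unfolding tr_term.simps by (intro fv_Ex_block D) simp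
next
  case (Mul s t)
  have "fv (tr_term D (N + 2) (d + 2) s 1) \<subseteq> {..<(N + 2) * dim D + npar D}"
    "fv (tr_term D (N + 2) (d + 2) t 0) \<subseteq> {..<(N + 2) * dim D + npar D}"
    using Mul.prems by (intro Mul.IH; simp)+
  moreover have "fv (inst D (N + 2) [1, 0, j + 2] (mul_fm D)) \<subseteq> {..<(N + 2) * dim D + npar D}"
    using Mul.prems is_code_bounds(6)[OF D] by (intro fv_inst) auto
  ultimately show ?case
    unfolding tr_term.simps by (intro fv_Ex_block D) simp
next
  case (Var i)
  then show ?case unfolding tr_term.simps using is_code_bounds(2)[OF D] by (intro fv_inst) (simp_all add: mult_2)
next
  case Zero
  then show ?case unfolding tr_term.simps using is_code_bounds(3)[OF D] by (intro fv_inst) simp_all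
next
  case One
  then show ?case unfolding tr_term.simps using is_code_bounds(4)[OF D] by (intro fv_inst) simp_all
qed

lemma fv_tr:
  assumes D: "is_code D"
  shows "fv F \<subseteq> {..<N} \<Longrightarrow> fv (tr D N F) \<subseteq> {..<N * dim D + npar D}"
proof (induction F arbitrary: N)
  case (Eq s t)
  have "fv (tr_term D (N + 1) 1 u 0) \<subseteq> {..<Suc N * dim D + npar D}" if "fv_term u \<subseteq> {..<N}" for u
    using fv_tr_term[OF D, of 0 "N + 1" u 1] that by auto
  then show ?case unfolding tr.simps using Eq by (intro fv_Ex_block D) simp
next
  case (Ex F)
  have "fv F \<subseteq> {..<N + 1}"
  proof
    fix i assume "i \<in> fv F" then show "i \<in> {..<N + 1}" using Ex.prems by (cases i) auto
  qed
  then show ?case unfolding tr.simps using Ex.IH[of "N + 1"] by (intro fv_Ex_block D) simp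
qed auto

section \<open>Well-definedness and coordinate maps as first-order conditions\<close>

lemma fv_quantI:
  assumes "fv F \<subseteq> {..<sum_list (n # ns)}"
  shows "fv (All_n n F) \<subseteq> {..<sum_list ns}" "fv ((Ex ^^ n) F) \<subseteq> {..<sum_list ns}"
  using assms by (fastforce simp: fv_Ex_pow)+

lemma fv_connI:
  assumes "fv F \<subseteq> A" "fv G \<subseteq> A"
  shows "fv (Conj F G) \<subseteq> A" "fv (Imp F G) \<subseteq> A" "fv (Iff F G) \<subseteq> A"
  using assms by auto

text \<open>The right-nested sums are what \<open>sum_list\<close> of a list of block lengths
  unfolds to.\<close>

lemma is_code_bounds_add:
  assumes "is_code C"
  shows "fv (dom_fm C) \<subseteq> {..<dim C + npar C}" "fv (eq_fm C) \<subseteq> {..<dim C + (dim C + npar C)}"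
    "fv (zero_fm C) \<subseteq> {..<dim C + npar C}" "fv (one_fm C) \<subseteq> {..<dim C + npar C}"
    "fv (add_fm C) \<subseteq> {..<dim C + (dim C + (dim C + npar C))}"
    "fv (mul_fm C) \<subseteq> {..<dim C + (dim C + (dim C + npar C))}"
  using is_code_bounds[OF assms] by (simp_all add: mult_2 numeral_3_eq_3 add.assoc)

section \<open>Well-definedness of an interpretation as a formula in its parameters\<close>

definition dom_at :: "code \<Rightarrow> nat list \<Rightarrow> nat \<Rightarrow> nat \<Rightarrow> fm" where
  "dom_at C ns i P = blk ns [i, P] (dom_fm C)"

definition rel_at :: "code \<Rightarrow> nat list \<Rightarrow> nat \<Rightarrow> nat \<Rightarrow> nat \<Rightarrow> fm" where
  "rel_at C ns i j P = Conj (dom_at C ns i P) (Conj (dom_at C ns j P) (blk ns [i, j, P] (eq_fm C)))"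

lemma satb_dom_at:
  assumes "is_code C" "ns = map length xs" "i < length xs" "P < length xs"
    "length (xs ! P) = npar C" "xs ! i \<in> tuples S (dim C)"
  shows "satb S xs (dom_at C ns i P) \<longleftrightarrow> xs ! i \<in> code_dom S C (xs ! P)"
  using assms is_code_bounds_add(1)[OF assms(1)] tuples_length[OF assms(6)]
  unfolding dom_at_def by (subst satb_blk) (auto simp: code_dom_def)

lemma satb_rel_at:
  assumes "is_code C" "ns = map length xs" "i < length xs" "j < length xs" "P < length xs"
    "length (xs ! P) = npar C" "xs ! i \<in> tuples S (dim C)" "xs ! j \<in> tuples S (dim C)"
  shows "satb S xs (rel_at C ns i j P) \<longleftrightarrow> (xs ! i, xs ! j) \<in> code_rel S C (xs ! P)"
proof -
  have "satb S xs (blk ns [i, j, P] (eq_fm C)) = sat S (xs ! i @ xs ! j @ xs ! P) (eq_fm C)"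
    using assms is_code_bounds_add(2)[OF assms(1)] assms(7,8)[THEN tuples_length]
    by (subst satb_blk) auto
  then show ?thesis unfolding rel_at_def using assms by (simp add: satb_dom_at code_rel_def)
qed

lemma fv_dom_at:
  assumes "is_code C" "i < length ns" "P < length ns" "ns ! i = dim C" "ns ! P = npar C"
  shows "fv (dom_at C ns i P) \<subseteq> {..<sum_list ns}"
  unfolding dom_at_def using assms is_code_bounds_add(1)[OF assms(1)] by (intro fv_blk) auto

lemma fv_rel_at:
  assumes "is_code C" "i < length ns" "j < length ns" "P < length ns"
    "ns ! i = dim C" "ns ! j = dim C" "ns ! P = npar C"
  shows "fv (rel_at C ns i j P) \<subseteq> {..<sum_list ns}"
proof -
  have "fv (blk ns [i, j, P] (eq_fm C)) \<subseteq> {..<sum_list ns}"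
    using assms is_code_bounds_add(2)[OF assms(1)] by (intro fv_blk) auto
  then show ?thesis unfolding rel_at_def using assms by (intro fv_connI fv_dom_at)
qed

text \<open>
  Blocks are numbered from the innermost quantifier outwards, so each new quantifier shifts the numbers
  by one and the parameter block is always the last.
\<close>

definition equiv_fm :: "code \<Rightarrow> fm" where
  "equiv_fm C = (let n = dim C; m = npar C in
     Conj (All_n n (Imp (dom_at C [n, m] 0 1) (rel_at C [n, m] 0 0 1)))
       (All_n n (All_n n (Imp (rel_at C [n, n, m] 1 0 2)
         (Conj (rel_at C [n, n, m] 0 1 2)
           (All_n n (Imp (rel_at C [n, n, n, m] 1 0 3) (rel_at C [n, n, n, m] 2 0 3))))))))"

text \<open>This is the right-hand side of \<open>Collect_mem_quotient_iff\<close>; under the inner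
  quantifier the chosen representative is block 1 and the running element block 0.\<close>

definition const_fm :: "code \<Rightarrow> fm \<Rightarrow> fm" where
  "const_fm C F = (let n = dim C; m = npar C in
     (Ex ^^ n) (Conj (dom_at C [n, m] 0 1)
       (All_n n (Imp (dom_at C [n, n, m] 0 2) (Iff (blk [n, n, m] [0, 2] F) (rel_at C [n, n, m] 1 0 2))))))"

text \<open>The pairs of blocks (5, 4), (3, 2) and (1, 0) are the pairs x, x' and y, y' and z, z' of
  \<open>defines_op\<close>.\<close>

definition congr_fm :: "code \<Rightarrow> fm \<Rightarrow> fm" where
  "congr_fm C F = (let n = dim C; m = npar C; ns = [n, n, n, n, n, n, m] in
     All_n n (All_n n (All_n n (All_n n (All_n n (All_n n
       (Imp (Conj (rel_at C ns 5 4 6) (Conj (rel_at C ns 3 2 6) (rel_at C ns 1 0 6)))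
         (Iff (blk ns [5, 3, 1, 6] F) (blk ns [4, 2, 0, 6] F)))))))))"

text \<open>In the innermost scope blocks 3 and 2 are the arguments, block 1 is the chosen value and
  block 0 runs over the candidates compared with it.\<close>

definition total_fm :: "code \<Rightarrow> fm \<Rightarrow> fm" where
  "total_fm C F = (let n = dim C; m = npar C in
     All_n n (All_n n (Imp (Conj (dom_at C [n, n, m] 1 2) (dom_at C [n, n, m] 0 2))
       ((Ex ^^ n) (Conj (dom_at C [n, n, n, m] 0 3)
         (All_n n (Imp (dom_at C [n, n, n, n, m] 0 4)
           (Iff (blk [n, n, n, n, m] [3, 2, 0, 4] F) (rel_at C [n, n, n, n, m] 1 0 4)))))))))"

definition ok_fm :: "code \<Rightarrow> fm" where
  "ok_fm C = Conj (equiv_fm C) (Conj (Conj (const_fm C (zero_fm C)) (const_fm C (one_fm C)))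
     (Conj (Conj (congr_fm C (add_fm C)) (total_fm C (add_fm C)))
       (Conj (congr_fm C (mul_fm C)) (total_fm C (mul_fm C)))))"

lemma satb_equiv_fm:
  assumes "is_code C" "length p = npar C"
  shows "satb S [p] (equiv_fm C) \<longleftrightarrow> equiv (code_dom S C p) (code_rel S C p)"
proof -
  have "satb S [p] (equiv_fm C) \<longleftrightarrow>
    (\<forall>x\<in>tuples S (dim C). x \<in> code_dom S C p \<longrightarrow> (x, x) \<in> code_rel S C p) \<and>
    (\<forall>x\<in>tuples S (dim C). \<forall>y\<in>tuples S (dim C). (x, y) \<in> code_rel S C p \<longrightarrow> (y, x) \<in> code_rel S C p \<and>
      (\<forall>z\<in>tuples S (dim C). (y, z) \<in> code_rel S C p \<longrightarrow> (x, z) \<in> code_rel S C p))"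
    unfolding equiv_fm_def using assms by (simp add: Let_def satb_dom_at satb_rel_at tuples_length)
  moreover have r: "x \<in> code_dom S C p \<and> y \<in> code_dom S C p \<and> x \<in> tuples S (dim C) \<and> y \<in> tuples S (dim C)"
    if "(x, y) \<in> code_rel S C p" for x y
    using that by (auto simp: code_rel_def intro: code_dom_tuples)
  moreover have "refl_on (code_dom S C p) (code_rel S C p) \<longleftrightarrow>
      (\<forall>x\<in>tuples S (dim C). x \<in> code_dom S C p \<longrightarrow> (x, x) \<in> code_rel S C p)"
    unfolding refl_on_def using r code_dom_tuples[of _ S C p] by blast
  moreover have "sym (code_rel S C p) \<longleftrightarrow> (\<forall>x\<in>tuples S (dim C). \<forall>y\<in>tuples S (dim C).
      (x, y) \<in> code_rel S C p \<longrightarrow> (y, x) \<in> code_rel S C p)"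
    unfolding sym_def using r by blast
  moreover have "trans (code_rel S C p) \<longleftrightarrow> (\<forall>x\<in>tuples S (dim C). \<forall>y\<in>tuples S (dim C).
      (x, y) \<in> code_rel S C p \<longrightarrow>
      (\<forall>z\<in>tuples S (dim C). (y, z) \<in> code_rel S C p \<longrightarrow> (x, z) \<in> code_rel S C p))"
    unfolding trans_def using r by blast
  moreover have "code_rel S C p \<subseteq> code_dom S C p \<times> code_dom S C p" using r by auto
  ultimately show ?thesis unfolding equiv_def by blast
qed

text \<open>The left-hand side speaks of a set of tuples and of the set of all classes. Naming one
  member of the class removes both and leaves a condition that the language can express.\<close>

lemma Collect_mem_quotient_iff:
  assumes "equiv A E"
  shows "{x \<in> A. P x} \<in> A // E \<longleftrightarrow> (\<exists>x\<in>A. \<forall>y\<in>A. P y \<longleftrightarrow> (x, y) \<in> E)"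
proof -
  have "E `` {x} \<subseteq> A" for x using assms by (auto simp: equiv_def refl_on_def)
  then have "{y \<in> A. P y} = E `` {x} \<longleftrightarrow> (\<forall>y\<in>A. P y \<longleftrightarrow> (x, y) \<in> E)" for x by auto
  then show ?thesis by (auto simp: quotient_def)
qed

lemma satb_const_fm:
  assumes "is_code C" "length p = npar C" "equiv (code_dom S C p) (code_rel S C p)"
    and F: "fv F \<subseteq> {..<dim C + npar C}"
  shows "satb S [p] (const_fm C F) \<longleftrightarrow>
    {x \<in> code_dom S C p. sat S (x @ p) F} \<in> code_dom S C p // code_rel S C p"
proof -
  have "satb S [p] (const_fm C F) \<longleftrightarrow>
    (\<exists>x\<in>tuples S (dim C). x \<in> code_dom S C p \<and> (\<forall>y\<in>tuples S (dim C). y \<in> code_dom S C p \<longrightarrow>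
      (sat S (y @ p) F \<longleftrightarrow> (x, y) \<in> code_rel S C p)))"
    unfolding const_fm_def using assms
    by (simp add: Let_def satb_dom_at satb_rel_at satb_blk tuples_length)
  then show ?thesis
    unfolding Collect_mem_quotient_iff[OF assms(3)] using code_dom_tuples by blast
qed

lemma satb_op_fm:
  assumes "is_code C" "length p = npar C" "equiv (code_dom S C p) (code_rel S C p)"
    and F: "fv F \<subseteq> {..<dim C + (dim C + (dim C + npar C))}"
  shows "satb S [p] (congr_fm C F) \<and> satb S [p] (total_fm C F) \<longleftrightarrow> defines_op S C p F"
proof -
  have t: "satb S [p] (total_fm C F) \<longleftrightarrow>
    (\<forall>x\<in>tuples S (dim C). \<forall>y\<in>tuples S (dim C). x \<in> code_dom S C p \<and> y \<in> code_dom S C p \<longrightarrow>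
      (\<exists>z\<in>tuples S (dim C). z \<in> code_dom S C p \<and> (\<forall>w\<in>tuples S (dim C). w \<in> code_dom S C p \<longrightarrow>
      (sat S (x @ y @ w @ p) F \<longleftrightarrow> (z, w) \<in> code_rel S C p))))"
    unfolding total_fm_def using assms
    by (simp add: Let_def satb_dom_at satb_rel_at satb_blk tuples_length)
  have c: "satb S [p] (congr_fm C F) \<longleftrightarrow>
    (\<forall>x\<in>tuples S (dim C). \<forall>x'\<in>tuples S (dim C). \<forall>y\<in>tuples S (dim C). \<forall>y'\<in>tuples S (dim C).
     \<forall>z\<in>tuples S (dim C). \<forall>z'\<in>tuples S (dim C). (x, x') \<in> code_rel S C p \<and> (y, y') \<in> code_rel S C p \<and>
        (z, z') \<in> code_rel S C p \<longrightarrow> sat S (x @ y @ z @ p) F = sat S (x' @ y' @ z' @ p) F)"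
    unfolding congr_fm_def using assms
    by (simp add: Let_def satb_rel_at satb_blk tuples_length)
  have r: "(x, y) \<in> code_rel S C p \<Longrightarrow> x \<in> tuples S (dim C) \<and> y \<in> tuples S (dim C)" for x y
    by (auto simp: code_rel_def code_dom_tuples)
  have "satb S [p] (congr_fm C F) \<longleftrightarrow>
     (\<forall>x x' y y' z z'. (x, x') \<in> code_rel S C p \<and> (y, y') \<in> code_rel S C p \<and>
        (z, z') \<in> code_rel S C p \<longrightarrow> sat S (x @ y @ z @ p) F = sat S (x' @ y' @ z' @ p) F)"
    unfolding c using r by meson
  moreover have "satb S [p] (total_fm C F) \<longleftrightarrow>
    (\<forall>x\<in>code_dom S C p. \<forall>y\<in>code_dom S C p. \<exists>z\<in>code_dom S C p. \<forall>w\<in>code_dom S C p.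
      sat S (x @ y @ w @ p) F \<longleftrightarrow> (z, w) \<in> code_rel S C p)"
    unfolding t using code_dom_tuples by meson
  ultimately show ?thesis
    unfolding defines_op_def Collect_mem_quotient_iff[OF assms(3)] by simp
qed

lemma sat_ok_fm:
  assumes "is_code C" "length p = npar C"
  shows "sat S p (ok_fm C) \<longleftrightarrow> interp_ok S C p"
proof -
  note b = is_code_bounds_add[OF assms(1)]
  have "sat S p (ok_fm C) = satb S [p] (ok_fm C)" by (simp add: satb_def)
  also have "\<dots> \<longleftrightarrow> interp_ok S C p"
    \<comment> \<open>The lemmas on constants and operations presuppose an equivalence relation,
      which the first conjunct of \<open>ok_fm\<close> supplies.\<close>
    unfolding ok_fm_def satb_simps interp_ok_def satb_equiv_fm[OF assms]
    using satb_const_fm[OF assms _ b(3)] satb_const_fm[OF assms _ b(4)]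
      satb_op_fm[OF assms _ b(5)] satb_op_fm[OF assms _ b(6)]
    by (auto simp: interp_def)
  finally show ?thesis .
qed

lemma fv_const_fm:
  assumes "is_code C" "fv F \<subseteq> {..<dim C + npar C}"
  shows "fv (const_fm C F) \<subseteq> {..<sum_list [npar C]}"
  unfolding const_fm_def Let_def using assms
  by (intro fv_quantI fv_connI fv_dom_at fv_rel_at fv_blk) simp_all

lemma fv_congr_fm:
  assumes "is_code C" "fv F \<subseteq> {..<dim C + (dim C + (dim C + npar C))}"
  shows "fv (congr_fm C F) \<subseteq> {..<sum_list [npar C]}"
  unfolding congr_fm_def Let_def using assms
  by (intro fv_quantI fv_connI fv_dom_at fv_rel_at fv_blk) simp_all

lemma fv_total_fm:
  assumes "is_code C" "fv F \<subseteq> {..<dim C + (dim C + (dim C + npar C))}"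
  shows "fv (total_fm C F) \<subseteq> {..<sum_list [npar C]}"
  unfolding total_fm_def Let_def using assms
  by (intro fv_quantI fv_connI fv_dom_at fv_rel_at fv_blk) simp_all

lemma fv_ok_fm:
  assumes "is_code C"
  shows "fv (ok_fm C) \<subseteq> {..<npar C}"
proof -
  have "fv (equiv_fm C) \<subseteq> {..<sum_list [npar C]}"
    unfolding equiv_fm_def Let_def using assms
    by (intro fv_quantI fv_connI fv_dom_at fv_rel_at fv_blk) simp_all
  then have "fv (ok_fm C) \<subseteq> {..<sum_list [npar C]}"
    unfolding ok_fm_def using assms is_code_bounds_add[OF assms]
    by (intro fv_connI fv_const_fm fv_congr_fm fv_total_fm)
  then show ?thesis by simp
qed

text \<open>\<open>ok_fm\<close> holds at all admissible parameters of \<open>S\<close>, and this is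
  a sentence. The translation lemmas can be used in \<open>T\<close> only after this step.\<close>

lemma elem_equiv_interp_ok:
  assumes "elem_equiv S T" "is_code C" "fv \<phi> \<subseteq> {..<npar C}"
    and "\<And>p. p \<in> defset S (npar C) \<phi> \<Longrightarrow> interp_ok S C p" and "p \<in> defset T (npar C) \<phi>"
  shows "interp_ok T C p"
proof -
  have "sat T p (ok_fm C)"
    using assms(1,3) fv_ok_fm[OF assms(2)]
  proof (rule elem_equiv_transfer_defset)
    show "sat S e (ok_fm C)" if "e \<in> defset S (npar C) \<phi>" for e
      using assms(4)[OF that] that by (simp add: sat_ok_fm[OF assms(2)] defset_def tuples_def)
  qed (rule assms(5))
  then show ?thesis using assms(5) by (simp add: sat_ok_fm[OF assms(2)] defset_def tuples_def)
qed

section \<open>Coordinate maps as a first-order condition\<close>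

text \<open>\<open>defines_coordinate_map\<close> quantifies over a function and an isomorphism of a
  quotient. Here only the relation defined by \<theta> occurs: its first components are the whole
  domain, every element is a value, and the formulas of the code match the structure of
  \<open>S\<close> on values. Where \<open>eq_fm\<close> is reflexive, its clause at
  \<open>u = v\<close> makes the relation single-valued.\<close>

definition coord_graph :: "fm \<Rightarrow> 'a ring \<Rightarrow> code \<Rightarrow> 'a list \<Rightarrow> bool" where
  "coord_graph \<theta> S C r \<longleftrightarrow>
    (\<forall>u\<in>tuples S (dim C). \<forall>a\<in>carrier S. sat S (u @ [a] @ r) \<theta> \<longrightarrow>
      u \<in> code_dom S C r \<and> (sat S (u @ r) (zero_fm C) \<longleftrightarrow> a = \<zero>\<^bsub>S\<^esub>) \<and>
      (sat S (u @ r) (one_fm C) \<longleftrightarrow> a = \<one>\<^bsub>S\<^esub>)) \<and>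
    (\<forall>u\<in>tuples S (dim C). u \<in> code_dom S C r \<longrightarrow> (\<exists>a\<in>carrier S. sat S (u @ [a] @ r) \<theta>)) \<and>
    (\<forall>a\<in>carrier S. \<exists>u\<in>tuples S (dim C). sat S (u @ [a] @ r) \<theta>) \<and>
    (\<forall>u\<in>tuples S (dim C). \<forall>a\<in>carrier S. sat S (u @ [a] @ r) \<theta> \<longrightarrow>
      (\<forall>v\<in>tuples S (dim C). \<forall>b\<in>carrier S. sat S (v @ [b] @ r) \<theta> \<longrightarrow>
        (sat S (u @ v @ r) (eq_fm C) \<longleftrightarrow> a = b) \<and>
        (\<forall>w\<in>tuples S (dim C). \<forall>c\<in>carrier S. sat S (w @ [c] @ r) \<theta> \<longrightarrow>
          (sat S (u @ v @ w @ r) (add_fm C) \<longleftrightarrow> a \<oplus>\<^bsub>S\<^esub> b = c) \<and>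
          (sat S (u @ v @ w @ r) (mul_fm C) \<longleftrightarrow> a \<otimes>\<^bsub>S\<^esub> b = c))))"

text \<open>For a pair (u, a) the tuple is quantified before the value, so apart from the final
  parameter block the values have even and the tuples odd numbers in \<open>n2\<close>,
  \<open>n4\<close> and \<open>n6\<close>. In the surjectivity clause the value comes first, hence
  the list \<open>[n, 1, m]\<close>.\<close>

definition coord_fm :: "fm \<Rightarrow> code \<Rightarrow> fm" where
  "coord_fm \<theta> C = (let n = dim C; m = npar C; n2 = [1, n, m]; n4 = [1, n, 1, n, m];
       n6 = [1, n, 1, n, 1, n, m] in
     Conj (All_n n (All_n 1 (Imp (blk n2 [1, 0, 2] \<theta>)
       (Conj (dom_at C n2 1 2)
         (Conj (Iff (blk n2 [1, 2] (zero_fm C)) (blk n2 [0] (Eq (Var 0) Zero)))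
           (Iff (blk n2 [1, 2] (one_fm C)) (blk n2 [0] (Eq (Var 0) One))))))))
    (Conj (All_n n (Imp (dom_at C [n, m] 0 1) ((Ex ^^ 1) (blk n2 [1, 0, 2] \<theta>))))
    (Conj (All_n 1 ((Ex ^^ n) (blk [n, 1, m] [0, 1, 2] \<theta>)))
    (All_n n (All_n 1 (Imp (blk n2 [1, 0, 2] \<theta>)
      (All_n n (All_n 1 (Imp (blk n4 [1, 0, 4] \<theta>)
        (Conj (Iff (blk n4 [3, 1, 4] (eq_fm C)) (blk n4 [2, 0] (Eq (Var 0) (Var 1))))
         (All_n n (All_n 1 (Imp (blk n6 [1, 0, 6] \<theta>)
          (Conj (Iff (blk n6 [5, 3, 1, 6] (add_fm C)) (blk n6 [4, 2, 0] (Eq (Add (Var 0) (Var 1)) (Var 2))))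
            (Iff (blk n6 [5, 3, 1, 6] (mul_fm C))
              (blk n6 [4, 2, 0] (Eq (Mul (Var 0) (Var 1)) (Var 2))))))))))))))))))"

lemma ball_bex_tuples_1:
  "(\<forall>x\<in>tuples S (Suc 0). P x) \<longleftrightarrow> (\<forall>a\<in>carrier S. P [a])"
  "(\<exists>x\<in>tuples S (Suc 0). P x) \<longleftrightarrow> (\<exists>a\<in>carrier S. P [a])"
  by (fastforce simp: tuples_def length_Suc_conv)+

lemma satb_Ex: "satb S xs (Ex F) \<longleftrightarrow> (\<exists>a\<in>carrier S. satb S ([a] # xs) F)"
  by (simp add: satb_def)

lemma sat_coord_fm:
  assumes "is_code C" "fv \<theta> \<subseteq> {..<dim C + 1 + npar C}" "length r = npar C"
  shows "sat S r (coord_fm \<theta> C) \<longleftrightarrow> coord_graph \<theta> S C r"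
proof -
  have "fv \<theta> \<subseteq> {..<dim C + Suc (npar C)}" "fv \<theta> \<subseteq> {..<Suc (dim C + npar C)}" using assms(2) by auto
  then have "satb S [r] (coord_fm \<theta> C) \<longleftrightarrow> coord_graph \<theta> S C r"
    unfolding coord_fm_def coord_graph_def Let_def using assms(1,3) is_code_bounds_add[OF assms(1)]
    by (simp add: satb_dom_at satb_blk satb_Ex tuples_length ball_bex_tuples_1)
  then show ?thesis by (simp add: satb_def)
qed

lemma fv_coord_fm:
  assumes "is_code C" "fv \<theta> \<subseteq> {..<dim C + 1 + npar C}"
  shows "fv (coord_fm \<theta> C) \<subseteq> {..<npar C}"
proof -
  have "fv \<theta> \<subseteq> {..<dim C + Suc (npar C)}" "fv \<theta> \<subseteq> {..<Suc (dim C + npar C)}" using assms(2) by auto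
  then have "fv (coord_fm \<theta> C) \<subseteq> {..<sum_list [npar C]}"
    unfolding coord_fm_def Let_def using is_code_bounds_add[OF assms(1)] assms(1)
    by (intro fv_quantI fv_connI fv_dom_at fv_rel_at fv_blk) simp_all
  then show ?thesis by simp
qed

text \<open>Membership and satisfaction stay one conjunction, the shape in which the values of the
  chosen map \<open>g\<close> will be given in
  \<open>isomorphic_interp_of_coord_graph\<close>.\<close>

lemma coord_graphD:
  assumes "coord_graph \<theta> S C r"
  shows "u \<in> code_dom S C r \<Longrightarrow> \<exists>a. a \<in> carrier S \<and> sat S (u @ [a] @ r) \<theta>"
    and "a \<in> carrier S \<Longrightarrow> \<exists>u\<in>tuples S (dim C). sat S (u @ [a] @ r) \<theta>"
    and "u \<in> tuples S (dim C) \<Longrightarrow> a \<in> carrier S \<and> sat S (u @ [a] @ r) \<theta> \<Longrightarrow>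
      u \<in> code_dom S C r \<and> (sat S (u @ r) (zero_fm C) \<longleftrightarrow> a = \<zero>\<^bsub>S\<^esub>) \<and>
      (sat S (u @ r) (one_fm C) \<longleftrightarrow> a = \<one>\<^bsub>S\<^esub>)"
    and "u \<in> tuples S (dim C) \<Longrightarrow> a \<in> carrier S \<and> sat S (u @ [a] @ r) \<theta> \<Longrightarrow>
      v \<in> tuples S (dim C) \<Longrightarrow> b \<in> carrier S \<and> sat S (v @ [b] @ r) \<theta> \<Longrightarrow>
      sat S (u @ v @ r) (eq_fm C) \<longleftrightarrow> a = b"
    and "u \<in> tuples S (dim C) \<Longrightarrow> a \<in> carrier S \<and> sat S (u @ [a] @ r) \<theta> \<Longrightarrow>
      v \<in> tuples S (dim C) \<Longrightarrow> b \<in> carrier S \<and> sat S (v @ [b] @ r) \<theta> \<Longrightarrow>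
      w \<in> tuples S (dim C) \<Longrightarrow> c \<in> carrier S \<and> sat S (w @ [c] @ r) \<theta> \<Longrightarrow>
      (sat S (u @ v @ w @ r) (add_fm C) \<longleftrightarrow> a \<oplus>\<^bsub>S\<^esub> b = c) \<and>
      (sat S (u @ v @ w @ r) (mul_fm C) \<longleftrightarrow> a \<otimes>\<^bsub>S\<^esub> b = c)"
proof -
  note G = assms[unfolded coord_graph_def]
  note G4 = G[THEN conjunct2, THEN conjunct2, THEN conjunct2, rule_format]
  show "u \<in> code_dom S C r \<Longrightarrow> \<exists>a. a \<in> carrier S \<and> sat S (u @ [a] @ r) \<theta>"
    using G[THEN conjunct2, THEN conjunct1, rule_format, OF code_dom_tuples] by blast
  show "a \<in> carrier S \<Longrightarrow> \<exists>u\<in>tuples S (dim C). sat S (u @ [a] @ r) \<theta>"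
    by (rule G[THEN conjunct2, THEN conjunct2, THEN conjunct1, rule_format])
  show "u \<in> tuples S (dim C) \<Longrightarrow> a \<in> carrier S \<and> sat S (u @ [a] @ r) \<theta> \<Longrightarrow>
      u \<in> code_dom S C r \<and> (sat S (u @ r) (zero_fm C) \<longleftrightarrow> a = \<zero>\<^bsub>S\<^esub>) \<and>
      (sat S (u @ r) (one_fm C) \<longleftrightarrow> a = \<one>\<^bsub>S\<^esub>)"
    using G[THEN conjunct1] by blast
  show "u \<in> tuples S (dim C) \<Longrightarrow> a \<in> carrier S \<and> sat S (u @ [a] @ r) \<theta> \<Longrightarrow>
      v \<in> tuples S (dim C) \<Longrightarrow> b \<in> carrier S \<and> sat S (v @ [b] @ r) \<theta> \<Longrightarrow>
      sat S (u @ v @ r) (eq_fm C) \<longleftrightarrow> a = b"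
    using G4[THEN conjunct1, of u a v b] by blast
  show "u \<in> tuples S (dim C) \<Longrightarrow> a \<in> carrier S \<and> sat S (u @ [a] @ r) \<theta> \<Longrightarrow>
      v \<in> tuples S (dim C) \<Longrightarrow> b \<in> carrier S \<and> sat S (v @ [b] @ r) \<theta> \<Longrightarrow>
      w \<in> tuples S (dim C) \<Longrightarrow> c \<in> carrier S \<and> sat S (w @ [c] @ r) \<theta> \<Longrightarrow>
      (sat S (u @ v @ w @ r) (add_fm C) \<longleftrightarrow> a \<oplus>\<^bsub>S\<^esub> b = c) \<and>
      (sat S (u @ v @ w @ r) (mul_fm C) \<longleftrightarrow> a \<otimes>\<^bsub>S\<^esub> b = c)"
    using G4[THEN conjunct2, rule_format, of u a v b w c] by blast
qed

text \<open>The map \<open>f\<close> is the isomorphism \<open>h\<close> after the class map, so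
  each clause is a property of \<open>h\<close> rewritten at representatives. Closure of the
  quotient is used because injectivity of \<open>h\<close> is applied to sums and products of
  classes.\<close>

lemma coord_graph_of_defines_coordinate_map:
  assumes "defines_coordinate_map \<theta> S C r"
  shows "coord_graph \<theta> S C r"
proof -
  obtain f h where ok: "interp_ok S C r" and onto: "f ` code_dom S C r = carrier S"
    and h: "h \<in> struct_iso (interp S C r) S"
    and f: "\<And>x. x \<in> code_dom S C r \<Longrightarrow> f x = h (cls S C r x)"
    and gr: "{(u, a). u \<in> tuples S (dim C) \<and> a \<in> carrier S \<and> sat S (u @ [a] @ r) \<theta>} =
        {(u, f u) | u. u \<in> code_dom S C r}"
    using assms unfolding defines_coordinate_map_def coordinate_map_def by blast
  have G: "sat S (u @ [a] @ r) \<theta> \<longleftrightarrow> u \<in> code_dom S C r \<and> a = f u"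
    if "u \<in> tuples S (dim C)" "a \<in> carrier S" for u a
    using that gr by (auto simp: set_eq_iff)
  let ?I = "interp S C r"
  have hom: "h (c \<oplus>\<^bsub>?I\<^esub> d) = h c \<oplus>\<^bsub>S\<^esub> h d" "h (c \<otimes>\<^bsub>?I\<^esub> d) = h c \<otimes>\<^bsub>S\<^esub> h d"
    if "c \<in> carrier ?I" "d \<in> carrier ?I" for c d
    using h that by (simp_all add: struct_iso_def ring_iso_def ring_hom_def)
  have h01: "h \<zero>\<^bsub>?I\<^esub> = \<zero>\<^bsub>S\<^esub>" "h \<one>\<^bsub>?I\<^esub> = \<one>\<^bsub>S\<^esub>"
    using h by (simp_all add: struct_iso_def ring_iso_def ring_hom_def)
  have inj: "h c = h d \<longleftrightarrow> c = d" if "c \<in> carrier ?I" "d \<in> carrier ?I" for c d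
    using h that by (auto simp: struct_iso_def ring_iso_def bij_betw_def inj_on_def)
  have cl: "\<zero>\<^bsub>?I\<^esub> \<in> carrier ?I" "\<one>\<^bsub>?I\<^esub> \<in> carrier ?I"
    "\<And>c d. c \<in> carrier ?I \<Longrightarrow> d \<in> carrier ?I \<Longrightarrow> c \<oplus>\<^bsub>?I\<^esub> d \<in> carrier ?I"
    "\<And>c d. c \<in> carrier ?I \<Longrightarrow> d \<in> carrier ?I \<Longrightarrow> c \<otimes>\<^bsub>?I\<^esub> d \<in> carrier ?I"
    using interp_ok_closed_struct[OF ok] by (auto simp: closed_struct_def)
  have z: "sat S (u @ r) (zero_fm C) \<longleftrightarrow> f u = \<zero>\<^bsub>S\<^esub>" "sat S (u @ r) (one_fm C) \<longleftrightarrow> f u = \<one>\<^bsub>S\<^esub>"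
    if u: "u \<in> code_dom S C r" for u
    unfolding f[OF u] h01[symmetric] inj[OF cls_in_carrier[OF u] cl(1)] inj[OF cls_in_carrier[OF u] cl(2)]
    using interp_ok_ops(1,2)[OF ok u] by simp_all
  have e: "sat S (u @ v @ r) (eq_fm C) \<longleftrightarrow> f u = f v"
    if u: "u \<in> code_dom S C r" and v: "v \<in> code_dom S C r" for u v
    unfolding f[OF u] f[OF v] inj[OF cls_in_carrier[OF u] cls_in_carrier[OF v]]
    using cls_eq_iff[OF ok u v] by simp
  have o: "sat S (u @ v @ w @ r) (add_fm C) \<longleftrightarrow> f u \<oplus>\<^bsub>S\<^esub> f v = f w"
    "sat S (u @ v @ w @ r) (mul_fm C) \<longleftrightarrow> f u \<otimes>\<^bsub>S\<^esub> f v = f w"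
    if u: "u \<in> code_dom S C r" and v: "v \<in> code_dom S C r" and w: "w \<in> code_dom S C r" for u v w
  proof -
    note c = cls_in_carrier[OF u] cls_in_carrier[OF v] cls_in_carrier[OF w]
    show "sat S (u @ v @ w @ r) (add_fm C) \<longleftrightarrow> f u \<oplus>\<^bsub>S\<^esub> f v = f w"
      "sat S (u @ v @ w @ r) (mul_fm C) \<longleftrightarrow> f u \<otimes>\<^bsub>S\<^esub> f v = f w"
      unfolding f[OF u] f[OF v] f[OF w] hom[OF c(1,2), symmetric] inj[OF cl(3)[OF c(1,2)] c(3)]
        inj[OF cl(4)[OF c(1,2)] c(3)]
      using interp_ok_ops(3,4)[OF ok u v w] by simp_all
  qed
  have fc: "f u \<in> carrier S" if "u \<in> code_dom S C r" for u using that onto by blast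
  have ex: "\<exists>u\<in>tuples S (dim C). sat S (u @ [a] @ r) \<theta>" if "a \<in> carrier S" for a
  proof -
    obtain u where "u \<in> code_dom S C r" "a = f u" using \<open>a \<in> carrier S\<close> onto by blast
    then show ?thesis using G[OF code_dom_tuples that] code_dom_tuples by blast
  qed
  show ?thesis
    unfolding coord_graph_def
  proof (intro conjI ballI impI, goal_cases)
    \<comment> \<open>Goals 4 and 5 are totality and surjectivity; the remaining ones follow from
      the equivalences \<open>G\<close>, \<open>z\<close>, \<open>e\<close> and
      \<open>o\<close>.\<close>
    case (4 u)
    then show ?case using G fc by blast
  next
    case (5 a)
    then show ?case by (rule ex)
  qed (simp_all only: G z e o)
qed

section \<open>Composite interpretations\<close>

lemma sat_blocks_in_dom:
  assumes D: "is_code D" "length q = npar D" and xs: "set xs \<subseteq> tuples S (dim D)" "N = length xs"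
  shows "l \<le> N \<Longrightarrow> sat S (concat xs @ q) (blocks_in_dom D N l F) \<longleftrightarrow>
    (\<forall>i<l. xs ! i \<in> code_dom S D q) \<and> sat S (concat xs @ q) F"
proof (induction l arbitrary: F)
  case (Suc l)
  have len: "\<forall>x\<in>set xs. length x = dim D" using xs(1) tuples_length by blast
  have "sat S (concat xs @ q) (inst D N [l] (dom_fm D)) = sat S (xs ! l @ q) (dom_fm D)"
    using len D xs Suc.prems is_code_bounds(1)[OF D(1)] by (subst sat_inst) auto
  moreover have "xs ! l \<in> tuples S (dim D)" using xs Suc.prems by auto
  ultimately show ?case
    using Suc.IH[of "Conj (inst D N [l] (dom_fm D)) F"] Suc.prems
    by (auto simp: blocks_in_dom_def code_dom_def less_Suc_eq)
qed (simp add: blocks_in_dom_def)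

lemma fv_blocks_in_dom:
  assumes D: "is_code D" and F: "fv F \<subseteq> {..<N * dim D + npar D}"
  shows "l \<le> N \<Longrightarrow> fv (blocks_in_dom D N l F) \<subseteq> {..<N * dim D + npar D}"
  using F
proof (induction l arbitrary: F)
  case (Suc l)
  have "fv (inst D N [l] (dom_fm D)) \<subseteq> {..<N * dim D + npar D}"
    using Suc.prems is_code_bounds(1)[OF D] by (intro fv_inst) auto
  then show ?case
    using Suc.IH[of "Conj (inst D N [l] (dom_fm D)) F"] Suc.prems by (simp add: blocks_in_dom_def)
qed (simp add: blocks_in_dom_def)

lemma is_code_comp_code:
  assumes "is_code C" "is_code D"
  shows "is_code (comp_code C D)"
proof -
  note t = fv_tr[OF assms(2)] and b = is_code_bounds[OF assms(1)]
  show ?thesis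
    unfolding is_code_def
    using fv_blocks_in_dom[OF assms(2) t[OF b(1)], of "dim C"] t[OF b(2)] t[OF b(3)] t[OF b(4)]
      t[OF b(5)] t[OF b(6)]
    by (simp add: comp_code_def algebra_simps)
qed

lemma tuples_split_blocks:
  "x \<in> tuples S (n * d) \<Longrightarrow> \<exists>us. length us = n \<and> set us \<subseteq> tuples S d \<and> concat us = x"
proof (induction n arbitrary: x)
  case (Suc n)
  then have "drop d x \<in> tuples S (n * d)" "take d x \<in> tuples S d"
    by (auto simp: tuples_def dest: in_set_takeD in_set_dropD)
  moreover obtain us where "length us = n" "set us \<subseteq> tuples S d" "concat us = drop d x"
    using Suc.IH calculation(1) by blast
  ultimately have "length (take d x # us) = Suc n \<and> set (take d x # us) \<subseteq> tuples S d \<and>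
      concat (take d x # us) = x" by simp
  then show ?case by blast
qed simp

lemma concat_tuples: "set us \<subseteq> tuples S d \<Longrightarrow> concat us \<in> tuples S (length us * d)"
  by (induction us) (auto simp: tuples_def)

lemma cls_tuples: "set us \<subseteq> code_dom S D q \<Longrightarrow> map (cls S D q) us \<in> tuples (interp S D q) (length us)"
  by (auto simp: tuples_def intro: cls_in_carrier)

text \<open>\<open>sat_tr\<close> covers only blocks in the domain of \<open>D\<close>. Therefore
  the domain formula of the composite first checks its \<open>dim C\<close> leading blocks; the
  parameter blocks \<open>bs\<close> satisfy the condition by hypothesis.\<close>

lemma code_dom_comp_code:
  assumes C: "is_code C" and D: "is_code D" "interp_ok S D q" "length q = npar D"
    and bs: "set bs \<subseteq> code_dom S D q" "length bs = npar C"
  shows "u \<in> code_dom S (comp_code C D) (concat bs @ q) \<longleftrightarrow>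
    (\<exists>us. u = concat us \<and> set us \<subseteq> code_dom S D q \<and>
      map (cls S D q) us \<in> code_dom (interp S D q) C (map (cls S D q) bs))"
proof -
  have *: "concat us \<in> code_dom S (comp_code C D) (concat bs @ q) \<longleftrightarrow> set us \<subseteq> code_dom S D q \<and>
      map (cls S D q) us \<in> code_dom (interp S D q) C (map (cls S D q) bs)"
    if us: "length us = dim C" "set us \<subseteq> tuples S (dim D)" for us
  proof -
    have "set (us @ bs) \<subseteq> tuples S (dim D)" using us(2) bs(1) code_dom_tuples[of _ S D q] by auto
    from sat_blocks_in_dom[OF D(1,3) this, of "dim C + npar C" "dim C"]
    have "sat S (concat us @ concat bs @ q) (dom_fm (comp_code C D)) \<longleftrightarrow>
      (\<forall>i<dim C. us ! i \<in> code_dom S D q) \<and>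
        sat S (concat (us @ bs) @ q) (tr D (dim C + npar C) (dom_fm C))"
      using us bs by (simp add: comp_code_def nth_append)
    moreover have "(\<forall>i<dim C. us ! i \<in> code_dom S D q) \<longleftrightarrow> set us \<subseteq> code_dom S D q"
      using us(1) by (auto simp: set_conv_nth)
    moreover have "sat S (concat (us @ bs) @ q) (tr D (dim C + npar C) (dom_fm C)) \<longleftrightarrow>
        sat (interp S D q) (map (cls S D q) (us @ bs)) (dom_fm C)" if "set us \<subseteq> code_dom S D q"
      using that us bs is_code_bounds(1)[OF C] by (intro sat_tr[OF D]) auto
    ultimately show ?thesis
      using concat_tuples[OF us(2)] us(1) cls_tuples[of us S D q]
      by (auto simp: code_dom_def comp_code_def)
  qed
  show ?thesis
  proof
    assume u: "u \<in> code_dom S (comp_code C D) (concat bs @ q)"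
    then have "u \<in> tuples S (dim C * dim D)" using code_dom_tuples by (fastforce simp: comp_code_def)
    then obtain us where "length us = dim C" "set us \<subseteq> tuples S (dim D)" "concat us = u"
      using tuples_split_blocks by blast
    then show "\<exists>us. u = concat us \<and> set us \<subseteq> code_dom S D q \<and>
      map (cls S D q) us \<in> code_dom (interp S D q) C (map (cls S D q) bs)"
      using * u by blast
  next
    assume "\<exists>us. u = concat us \<and> set us \<subseteq> code_dom S D q \<and>
      map (cls S D q) us \<in> code_dom (interp S D q) C (map (cls S D q) bs)"
    then obtain us where us: "u = concat us" "set us \<subseteq> code_dom S D q"
      "map (cls S D q) us \<in> code_dom (interp S D q) C (map (cls S D q) bs)" by blast
    moreover have "length us = dim C" using code_dom_length[OF us(3)] by simp
    moreover have "set us \<subseteq> tuples S (dim D)" using us(2) code_dom_tuples by blast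
    ultimately show "u \<in> code_dom S (comp_code C D) (concat bs @ q)" using * by blast
  qed
qed

text \<open>Choosing representatives turns a tuple \<open>y\<close> of classes into a tuple
  \<open>U y\<close> over \<open>S\<close>, and \<theta> relates that to some \<open>g y\<close> in
  \<open>S\<close>. The criterion \<open>isomorphic_interpI\<close> applied to \<open>g\<close>
  gives the result directly, without comparing the quotient of the composite code with the iterated
  one.\<close>

lemma isomorphic_interp_of_coord_graph:
  assumes C: "is_code C" and D: "is_code D" "interp_ok S D q" "length q = npar D"
    and bs: "set bs \<subseteq> code_dom S D q" "length bs = npar C"
    and ok: "interp_ok (interp S D q) C (map (cls S D q) bs)"
    and S: "closed_struct S"
    and G: "coord_graph \<theta> S (comp_code C D) (concat bs @ q)"
  shows "isomorphic S (interp (interp S D q) C (map (cls S D q) bs))"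
proof -
  let ?I = "interp S D q" and ?c = "cls S D q" and ?CD = "comp_code C D" and ?r = "concat bs @ q"
  let ?p = "map ?c bs"
  define rp where "rp c = (SOME x. x \<in> code_dom S D q \<and> ?c x = c)" for c
  have rp: "rp c \<in> code_dom S D q \<and> ?c (rp c) = c" if "c \<in> carrier ?I" for c
  proof -
    have "\<exists>x. x \<in> code_dom S D q \<and> ?c x = c" using that by (elim carrier_interpE) blast
    then show ?thesis unfolding rp_def by (rule someI_ex)
  qed
  define U where "U y = concat (map rp y)" for y
  have car: "set y \<subseteq> carrier ?I" if "y \<in> code_dom ?I C ?p" for y
    using code_dom_tuples[OF that] by (simp add: tuples_def)
  have rpY: "set (map rp Y) \<subseteq> code_dom S D q" "map ?c (map rp Y) = Y" if "set Y \<subseteq> carrier ?I" for Y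
    using rp that by (auto simp: subset_iff intro!: map_idI)
  have U: "U y \<in> code_dom S ?CD ?r" if "y \<in> code_dom ?I C ?p" for y
    unfolding code_dom_comp_code[OF C D bs] U_def using that rpY[OF car[OF that]] by metis
  have tr: "sat S (concat us @ ?r) (tr D N F) \<longleftrightarrow> sat ?I (map ?c us @ ?p) F"
    if "set us \<subseteq> code_dom S D q" "fv F \<subseteq> {..<N}" "N = length us + npar C" for us N F
    using sat_tr[OF D, of "us @ bs" F N] that bs by simp
  note b = is_code_bounds[OF C]
  have trU: "sat S (concat (map rp Y) @ ?r) (tr D N F) \<longleftrightarrow> sat ?I (Y @ ?p) F"
    if "set Y \<subseteq> carrier ?I" "fv F \<subseteq> {..<N}" "N = length Y + npar C" for Y N F
    using tr[OF rpY(1)[OF that(1)] that(2)] that(3) unfolding rpY(2)[OF that(1)] by simp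
  have tr1: "sat S (U y @ ?r) (zero_fm ?CD) \<longleftrightarrow> sat ?I (y @ ?p) (zero_fm C)"
    "sat S (U y @ ?r) (one_fm ?CD) \<longleftrightarrow> sat ?I (y @ ?p) (one_fm C)"
    if y: "y \<in> code_dom ?I C ?p" for y
    using trU[OF car[OF y] b(3)] trU[OF car[OF y] b(4)] code_dom_length[OF y]
    by (simp_all add: U_def comp_code_def)
  \<comment> \<open>The first argument is an arbitrary list of representatives, because surjectivity
    will start from a tuple supplied by \<theta> and not from some \<open>U y\<close>.\<close>
  have tr2: "sat S (concat us @ U y @ ?r) (eq_fm ?CD) \<longleftrightarrow> sat ?I (map ?c us @ y @ ?p) (eq_fm C)"
    if "set us \<subseteq> code_dom S D q" "length us = dim C" "y \<in> code_dom ?I C ?p" for us y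
  proof -
    note y = rpY[OF car[OF that(3)]]
    have "sat S (concat (us @ map rp y) @ ?r) (tr D (2 * dim C + npar C) (eq_fm C)) \<longleftrightarrow>
        sat ?I (map ?c (us @ map rp y) @ ?p) (eq_fm C)"
      using that y(1) code_dom_length[OF that(3)] by (intro tr b(2)) simp_all
    then show ?thesis unfolding map_append y(2) by (simp add: U_def comp_code_def)
  qed
  have tr3: "sat S (U x @ U y @ U z @ ?r) (add_fm ?CD) \<longleftrightarrow> sat ?I (x @ y @ z @ ?p) (add_fm C)"
    "sat S (U x @ U y @ U z @ ?r) (mul_fm ?CD) \<longleftrightarrow> sat ?I (x @ y @ z @ ?p) (mul_fm C)"
    if "x \<in> code_dom ?I C ?p" "y \<in> code_dom ?I C ?p" "z \<in> code_dom ?I C ?p" for x y z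
    using trU[OF _ b(5), of "x @ y @ z"] trU[OF _ b(6), of "x @ y @ z"] that[THEN car]
      that[THEN code_dom_length]
    by (simp_all add: U_def comp_code_def)
  define g where "g y = (SOME a. a \<in> carrier S \<and> sat S (U y @ [a] @ ?r) \<theta>)" for y
  have g: "g y \<in> carrier S \<and> sat S (U y @ [g y] @ ?r) \<theta>" if "y \<in> code_dom ?I C ?p" for y
    unfolding g_def using coord_graphD(1)[OF G U[OF that]] by (rule someI_ex)
  have Ut: "U y \<in> tuples S (dim ?CD)" if "y \<in> code_dom ?I C ?p" for y
    using code_dom_tuples[OF U[OF that]] .
  show ?thesis
    using S ok
  proof (rule isomorphic_interpI)
    show "g ` code_dom ?I C ?p = carrier S"
    proof
      show "carrier S \<subseteq> g ` code_dom ?I C ?p"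
      proof
        fix a assume a: "a \<in> carrier S"
        then obtain u where u: "u \<in> tuples S (dim ?CD)" "sat S (u @ [a] @ ?r) \<theta>"
          using coord_graphD(2)[OF G] by blast
        then have "u \<in> code_dom S ?CD ?r" using coord_graphD(3)[OF G u(1)] a by blast
        then obtain us where us: "u = concat us" "set us \<subseteq> code_dom S D q" "map ?c us \<in> code_dom ?I C ?p"
          unfolding code_dom_comp_code[OF C D bs] by blast
        \<comment> \<open>The blocks \<open>us\<close> and the chosen representatives in
          \<open>U y\<close> stand for the same classes. So \<open>eq_fm\<close> relates
          \<open>u\<close> to \<open>U y\<close>, and the clause of \<open>coord_graph\<close> on
          equality gives \<open>a = g y\<close>.\<close>
        define y where "y = map ?c us"
        have y: "y \<in> code_dom ?I C ?p" using us(3) by (simp add: y_def)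
        have "length us = dim C" using code_dom_length[OF us(3)] by simp
        moreover have "sat ?I (y @ y @ ?p) (eq_fm C)" using cls_eq_iff[OF ok y y] by simp
        ultimately have "sat S (u @ U y @ ?r) (eq_fm ?CD)"
          using tr2[OF us(2) _ y] us(1) unfolding y_def[symmetric] by blast
        then have "a = g y" using coord_graphD(4)[OF G u(1) _ Ut[OF y] g[OF y]] u(2) a by blast
        then show "a \<in> g ` code_dom ?I C ?p" using y by blast
      qed
    qed (use g in auto)
  next
    fix x y assume x: "x \<in> code_dom ?I C ?p" and y: "y \<in> code_dom ?I C ?p"
    show "g x = g y \<longleftrightarrow> sat ?I (x @ y @ ?p) (eq_fm C)"
      using coord_graphD(4)[OF G Ut[OF x] g[OF x] Ut[OF y] g[OF y]] tr2[OF rpY(1)[OF car[OF x]] _ y]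
        code_dom_length[OF x]
      unfolding rpY(2)[OF car[OF x]] U_def[symmetric] by simp
  next
    fix y assume y: "y \<in> code_dom ?I C ?p"
    show "g y = \<zero>\<^bsub>S\<^esub> \<longleftrightarrow> sat ?I (y @ ?p) (zero_fm C)"
      using coord_graphD(3)[OF G Ut[OF y] g[OF y]] tr1[OF y] by blast
    show "g y = \<one>\<^bsub>S\<^esub> \<longleftrightarrow> sat ?I (y @ ?p) (one_fm C)"
      using coord_graphD(3)[OF G Ut[OF y] g[OF y]] tr1[OF y] by blast
  next
    fix x y z
    assume *: "x \<in> code_dom ?I C ?p" "y \<in> code_dom ?I C ?p" "z \<in> code_dom ?I C ?p"
    show "g x \<oplus>\<^bsub>S\<^esub> g y = g z \<longleftrightarrow> sat ?I (x @ y @ z @ ?p) (add_fm C)"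
      using coord_graphD(5)[OF G Ut[OF *(1)] g[OF *(1)] Ut[OF *(2)] g[OF *(2)] Ut[OF *(3)] g[OF *(3)]]
        tr3(1)[OF *] by blast
    show "g x \<otimes>\<^bsub>S\<^esub> g y = g z \<longleftrightarrow> sat ?I (x @ y @ z @ ?p) (mul_fm C)"
      using coord_graphD(5)[OF G Ut[OF *(1)] g[OF *(1)] Ut[OF *(2)] g[OF *(2)] Ut[OF *(3)] g[OF *(3)]]
        tr3(2)[OF *] by blast
  qed
qed

text \<open>The translation of \<phi> means what it should only where the interpretation by
  \<open>D\<close> is well defined. The conjunct \<psi> in \<open>comp_par\<close> guarantees this
  through the hypothesis \<open>ok\<close>.\<close>

lemma defset_comp_par:
  assumes "is_code D" "fv \<phi> \<subseteq> {..<npar C}" "fv \<psi> \<subseteq> {..<npar D}"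
    and ok: "\<And>q. q \<in> defset S (npar D) \<psi> \<Longrightarrow> interp_ok S D q"
  shows "r \<in> defset S (npar (comp_code C D)) (comp_par C \<phi> D \<psi>) \<longleftrightarrow>
    (\<exists>bs q. r = concat bs @ q \<and> q \<in> defset S (npar D) \<psi> \<and> set bs \<subseteq> code_dom S D q \<and>
      map (cls S D q) bs \<in> defset (interp S D q) (npar C) \<phi>)"
proof -
  have *: "concat bs @ q \<in> defset S (npar (comp_code C D)) (comp_par C \<phi> D \<psi>) \<longleftrightarrow>
    q \<in> defset S (npar D) \<psi> \<and> set bs \<subseteq> code_dom S D q \<and>
      map (cls S D q) bs \<in> defset (interp S D q) (npar C) \<phi>"
    if bs: "length bs = npar C" "set bs \<subseteq> tuples S (dim D)" and q: "q \<in> tuples S (npar D)" for bs q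
  proof -
    have len: "length q = npar D" using tuples_length[OF q] .
    have t: "concat bs @ q \<in> tuples S (npar (comp_code C D))"
      using tuples_append[OF concat_tuples[OF bs(2)] q] bs(1) by (simp add: comp_code_def)
    have lc: "length (concat bs) = npar C * dim D"
      using tuples_length[OF concat_tuples[OF bs(2)]] bs(1) by simp
    have "sat S (concat bs @ q) (ren (\<lambda>i. npar C * dim D + i) \<psi>) = sat S q \<psi>"
      using lc by (intro sat_ren) (simp add: nth_append)
    moreover have "sat S (concat bs @ q) (blocks_in_dom D (npar C) (npar C) (tr D (npar C) \<phi>)) \<longleftrightarrow>
      set bs \<subseteq> code_dom S D q \<and> sat S (concat bs @ q) (tr D (npar C) \<phi>)"
      using sat_blocks_in_dom[OF assms(1) len bs(2), of "npar C" "npar C"] bs(1)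
      by (auto simp: set_conv_nth)
    moreover have "sat S (concat bs @ q) (tr D (npar C) \<phi>) \<longleftrightarrow>
        sat (interp S D q) (map (cls S D q) bs) \<phi>" if "set bs \<subseteq> code_dom S D q" "sat S q \<psi>"
      using that bs q len assms(2) ok[of q]
      by (intro sat_tr[OF assms(1)]) (auto simp: defset_def)
    ultimately show ?thesis
      using t q cls_tuples[of bs S D q] bs(1) by (auto simp: defset_def comp_par_def)
  qed
  show ?thesis
  proof
    assume r: "r \<in> defset S (npar (comp_code C D)) (comp_par C \<phi> D \<psi>)"
    then have "take (npar C * dim D) r \<in> tuples S (npar C * dim D)"
      and q: "drop (npar C * dim D) r \<in> tuples S (npar D)"
      by (auto simp: defset_def tuples_def comp_code_def dest: in_set_takeD in_set_dropD)
    then obtain bs where "length bs = npar C" "set bs \<subseteq> tuples S (dim D)"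
      "concat bs = take (npar C * dim D) r"
      using tuples_split_blocks by blast
    then show "\<exists>bs q. r = concat bs @ q \<and> q \<in> defset S (npar D) \<psi> \<and> set bs \<subseteq> code_dom S D q \<and>
      map (cls S D q) bs \<in> defset (interp S D q) (npar C) \<phi>"
      using *[OF _ _ q] r by (metis append_take_drop_id)
  next
    assume "\<exists>bs q. r = concat bs @ q \<and> q \<in> defset S (npar D) \<psi> \<and> set bs \<subseteq> code_dom S D q \<and>
      map (cls S D q) bs \<in> defset (interp S D q) (npar C) \<phi>"
    then obtain bs q where bq: "r = concat bs @ q" "q \<in> defset S (npar D) \<psi>" "set bs \<subseteq> code_dom S D q"
      "map (cls S D q) bs \<in> defset (interp S D q) (npar C) \<phi>" by blast
    moreover have "length bs = npar C" using bq(4) by (simp add: defset_def tuples_def)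
    moreover have "set bs \<subseteq> tuples S (dim D)" using bq(3) code_dom_tuples by blast
    moreover have "q \<in> tuples S (npar D)" using bq(2) by (simp add: defset_def)
    ultimately show "r \<in> defset S (npar (comp_code C D)) (comp_par C \<phi> D \<psi>)" using * by blast
  qed
qed

lemma fv_comp_par:
  assumes "is_code D" "fv \<phi> \<subseteq> {..<npar C}" "fv \<psi> \<subseteq> {..<npar D}"
  shows "fv (comp_par C \<phi> D \<psi>) \<subseteq> {..<npar (comp_code C D)}"
  using fv_blocks_in_dom[OF assms(1) fv_tr[OF assms(1,2)], of "npar C"] assms(3)
  by (auto simp: comp_par_def comp_code_def fv_ren)

section \<open>Transfer along elementary equivalence\<close>

text \<open>The ring axioms are packed into one formula in three variables, so a single transfer
  suffices; closure under the operations is taken from \<open>closed_struct\<close>.\<close>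

lemma ring_elem_equiv:
  assumes "ring S" "elem_equiv S T" "closed_struct T"
  shows "ring T"
proof -
  interpret S: ring S by (rule assms(1))
  \<comment> \<open>Under the \<open>Ex\<close>, \<open>Var 0\<close> is the additive inverse and
    \<open>Var 1\<close> the outer variable 0. The trailing \<open>Eq Zero Zero\<close> is the
    neutral end of the conjunction.\<close>
  define F where "F = foldr Conj
    [Eq (Add (Add (Var 0) (Var 1)) (Var 2)) (Add (Var 0) (Add (Var 1) (Var 2))),
     Eq (Add (Var 0) (Var 1)) (Add (Var 1) (Var 0)), Eq (Add Zero (Var 0)) (Var 0),
     Ex (Eq (Add (Var 0) (Var 1)) Zero),
     Eq (Mul (Mul (Var 0) (Var 1)) (Var 2)) (Mul (Var 0) (Mul (Var 1) (Var 2))),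
     Eq (Mul One (Var 0)) (Var 0), Eq (Mul (Var 0) One) (Var 0),
     Eq (Mul (Add (Var 0) (Var 1)) (Var 2)) (Add (Mul (Var 0) (Var 2)) (Mul (Var 1) (Var 2))),
     Eq (Mul (Var 2) (Add (Var 0) (Var 1))) (Add (Mul (Var 2) (Var 0)) (Mul (Var 2) (Var 1)))]
    (Eq Zero Zero)"
  have F: "sat T [x, y, z] F" if "x \<in> carrier T" "y \<in> carrier T" "z \<in> carrier T" for x y z
    using assms(2)
  proof (rule elem_equiv_transfer)
    show "fv F \<subseteq> {..<3}" by (auto simp: F_def)
    show "[x, y, z] \<in> tuples T 3" using that by (simp add: tuples_def)
    fix e assume "e \<in> tuples S 3"
    then obtain a b c where e: "e = [a, b, c]" "a \<in> carrier S" "b \<in> carrier S" "c \<in> carrier S"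
      by (auto simp: tuples_def numeral_3_eq_3 length_Suc_conv)
    moreover have "\<exists>d\<in>carrier S. d \<oplus>\<^bsub>S\<^esub> a = \<zero>\<^bsub>S\<^esub>"
      using e(2) by (intro bexI[of _ "\<ominus>\<^bsub>S\<^esub> a"]) (simp_all add: S.l_neg)
    ultimately show "sat S e F"
      by (simp add: F_def S.a_assoc S.m_assoc S.l_distr S.r_distr) (simp add: S.a_comm)
  qed
  note F' = F[unfolded F_def, simplified]
  have ax: "x \<oplus>\<^bsub>T\<^esub> y \<oplus>\<^bsub>T\<^esub> z = x \<oplus>\<^bsub>T\<^esub> (y \<oplus>\<^bsub>T\<^esub> z)" "x \<oplus>\<^bsub>T\<^esub> y = y \<oplus>\<^bsub>T\<^esub> x"
      "x \<otimes>\<^bsub>T\<^esub> y \<otimes>\<^bsub>T\<^esub> z = x \<otimes>\<^bsub>T\<^esub> (y \<otimes>\<^bsub>T\<^esub> z)"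
      "(x \<oplus>\<^bsub>T\<^esub> y) \<otimes>\<^bsub>T\<^esub> z = x \<otimes>\<^bsub>T\<^esub> z \<oplus>\<^bsub>T\<^esub> y \<otimes>\<^bsub>T\<^esub> z"
      "z \<otimes>\<^bsub>T\<^esub> (x \<oplus>\<^bsub>T\<^esub> y) = z \<otimes>\<^bsub>T\<^esub> x \<oplus>\<^bsub>T\<^esub> z \<otimes>\<^bsub>T\<^esub> y"
    if "x \<in> carrier T" "y \<in> carrier T" "z \<in> carrier T" for x y z
    using F'[OF that] by blast+
  have ax1: "\<zero>\<^bsub>T\<^esub> \<oplus>\<^bsub>T\<^esub> x = x" "\<exists>y\<in>carrier T. y \<oplus>\<^bsub>T\<^esub> x = \<zero>\<^bsub>T\<^esub>"
    "\<one>\<^bsub>T\<^esub> \<otimes>\<^bsub>T\<^esub> x = x" "x \<otimes>\<^bsub>T\<^esub> \<one>\<^bsub>T\<^esub> = x" if "x \<in> carrier T" for x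
    using F'[OF that that that] by blast+
  have c: "\<zero>\<^bsub>T\<^esub> \<in> carrier T" "\<one>\<^bsub>T\<^esub> \<in> carrier T"
    "\<And>x y. x \<in> carrier T \<Longrightarrow> y \<in> carrier T \<Longrightarrow> x \<oplus>\<^bsub>T\<^esub> y \<in> carrier T"
    "\<And>x y. x \<in> carrier T \<Longrightarrow> y \<in> carrier T \<Longrightarrow> x \<otimes>\<^bsub>T\<^esub> y \<in> carrier T"
    using assms(3) by (simp_all add: closed_struct_def)
  show ?thesis
    by (intro ringI abelian_groupI monoidI; (rule c ax ax1; assumption))
qed

lemma defset_struct_iso_nonempty:
  assumes "isomorphic S T" "closed_struct S" "fv F \<subseteq> {..<n}" "defset T n F \<noteq> {}"
  shows "defset S n F \<noteq> {}"
proof -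
  obtain h where h: "h \<in> struct_iso S T" using assms(1) by (auto simp: isomorphic_def)
  then have onto: "h ` carrier S = carrier T"
    by (simp add: struct_iso_def ring_iso_def bij_betw_def)
  obtain y where y: "length y = n" "set y \<subseteq> carrier T" "sat T y F"
    using assms(4) by (auto simp: defset_def tuples_def)
  define x where "x = map (inv_into (carrier S) h) y"
  have x: "set x \<subseteq> carrier S" "map h x = y" "length x = n"
    using y(1,2) unfolding onto[symmetric]
    by (auto simp: x_def subset_iff f_inv_into_f intro!: map_idI inv_into_into)
  then have "sat S x F" using struct_iso_sat[OF h assms(2) x(1), of F] assms(3) y(3) by simp
  then show ?thesis using x by (auto simp: defset_def tuples_def)
qed

lemma isomorphic_elem_equiv:
  assumes "isomorphic S T" "closed_struct S"
  shows "elem_equiv S T"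
proof -
  obtain h where "h \<in> struct_iso S T" using assms(1) by (auto simp: isomorphic_def)
  then show ?thesis using struct_iso_sat[of h S T "[]"] assms(2) by (simp add: elem_equiv_def)
qed

lemma elem_equiv_interp:
  assumes ST: "elem_equiv S T" and D: "is_code D" "fv \<psi> \<subseteq> {..<npar D}"
    and S: "\<And>q. q \<in> defset S (npar D) \<psi> \<Longrightarrow> interp_ok S D q \<and> elem_equiv (interp S D q) B"
    and q: "q \<in> defset T (npar D) \<psi>"
  shows "elem_equiv (interp T D q) B"
proof -
  have ok: "interp_ok T D q" using elem_equiv_interp_ok[OF ST D _ q] S by blast
  have tr: "sat T q (tr D 0 F) \<longleftrightarrow> sat (interp T D q) [] F" if "fv F = {}" for F
    using sat_tr[OF D(1) ok, of "[]" F 0] q that by (simp add: defset_def tuples_def)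
  show ?thesis
  proof (rule elem_equiv_sym, rule elem_equivI)
    fix F assume F: "fv F = {}" "sat B [] F"
    \<comment> \<open>A sentence is translated relative to 0 blocks, so only the parameters
      \<open>q\<close> can be free in the result.\<close>
    have fvt: "fv (tr D 0 F) \<subseteq> {..<npar D}" using fv_tr[OF D(1), of F 0] F(1) by simp
    show "sat (interp T D q) [] F"
      unfolding tr[OF F(1), symmetric] using ST D(2) fvt _ q
    proof (rule elem_equiv_transfer_defset)
      fix e assume e: "e \<in> defset S (npar D) \<psi>"
      then show "sat S e (tr D 0 F)"
        using S[OF e] F sat_tr[OF D(1), of S e "[]" F 0]
        by (auto simp: defset_def tuples_def elem_equiv_def)
    qed
  qed
qed

theorem theorem6p7:
  fixes k :: nat
    and R :: "'r ring"
    and R' :: "'a ring"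
    and \<Gamma> \<Delta> :: code
    and \<phi> \<psi> \<theta>\<^sub>R \<theta>\<^sub>Z :: fm
  assumes "k \<ge> 1"
    and "ring R"
    and "isomorphic R (int_poly_ring k) \<or> isomorphic R (int_laurent_ring k)"
    and "regular_biinterpretation \<Gamma> \<phi> \<Delta> \<psi> \<theta>\<^sub>R \<theta>\<^sub>Z R \<Z>"
    and "ring R'"
    and "elem_equiv R' R"
  shows "\<exists>(Zt :: 'a list set ring) p.
           ring Zt \<and> elem_equiv Zt \<Z> \<and> p \<in> defset Zt (npar \<Gamma>) \<phi> \<and>
           interp_ok Zt \<Gamma> p \<and> isomorphic R' (interp Zt \<Gamma> p)"
proof -
  let ?G\<Delta> = "comp_code \<Gamma> \<Delta>" and ?par = "comp_par \<Gamma> \<phi> \<Delta> \<psi>"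
  have G: "is_code \<Gamma>" "fv \<phi> \<subseteq> {..<npar \<Gamma>}" "defset \<Z> (npar \<Gamma>) \<phi> \<noteq> {}"
    "\<And>p. p \<in> defset \<Z> (npar \<Gamma>) \<phi> \<Longrightarrow> interp_ok \<Z> \<Gamma> p"
    and D: "is_code \<Delta>" "fv \<psi> \<subseteq> {..<npar \<Delta>}" "defset R (npar \<Delta>) \<psi> \<noteq> {}"
    "\<And>q. q \<in> defset R (npar \<Delta>) \<psi> \<Longrightarrow> interp_ok R \<Delta> q \<and> isomorphic (interp R \<Delta> q) \<Z>"
    and th: "fv \<theta>\<^sub>R \<subseteq> {..<dim ?G\<Delta> + 1 + npar ?G\<Delta>}"
    "\<And>r. r \<in> defset R (npar ?G\<Delta>) ?par \<Longrightarrow> defines_coordinate_map \<theta>\<^sub>R R ?G\<Delta> r"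
    using assms(4) unfolding regular_biinterpretation_def regular_interpretation_def by blast+
  have RR': "elem_equiv R R'" using elem_equiv_sym[OF assms(6)] .
  have okR: "interp_ok R \<Delta> q" if "q \<in> defset R (npar \<Delta>) \<psi>" for q using D(4)[OF that] ..
  have okR': "interp_ok R' \<Delta> q" if "q \<in> defset R' (npar \<Delta>) \<psi>" for q
    using elem_equiv_interp_ok[OF RR' D(1,2) okR that] .
  have fvp: "fv ?par \<subseteq> {..<npar ?G\<Delta>}" by (rule fv_comp_par[OF D(1) G(2) D(2)])

  obtain q0 where q0: "q0 \<in> defset R (npar \<Delta>) \<psi>" using D(3) by blast
  \<comment> \<open>Parameters for \<Gamma> are given in \<Z>; the isomorphism of \<Delta>(R, q0)
    with \<Z> pulls such a tuple back.\<close>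
  then have "defset (interp R \<Delta> q0) (npar \<Gamma>) \<phi> \<noteq> {}"
    using D(4)[OF q0] defset_struct_iso_nonempty[OF _ interp_ok_closed_struct G(2,3)] by blast
  then obtain p0 where p0: "p0 \<in> defset (interp R \<Delta> q0) (npar \<Gamma>) \<phi>" by blast
  then have "\<forall>c\<in>set p0. \<exists>x\<in>code_dom R \<Delta> q0. cls R \<Delta> q0 x = c"
    by (fastforce simp: defset_def tuples_def elim: carrier_interpE)
  \<comment> \<open>The condition \<open>comp_par\<close> is about tuples over \<open>R\<close>, so
    the classes in \<open>p0\<close> are lifted to representatives.\<close>
  then obtain rp where "\<forall>c\<in>set p0. rp c \<in> code_dom R \<Delta> q0 \<and> cls R \<Delta> q0 (rp c) = c" by metis
  then have "set (map rp p0) \<subseteq> code_dom R \<Delta> q0" "map (cls R \<Delta> q0) (map rp p0) = p0"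
    by (auto intro!: map_idI)
  then have "\<exists>bs q. concat (map rp p0) @ q0 = concat bs @ q \<and> q \<in> defset R (npar \<Delta>) \<psi> \<and>
      set bs \<subseteq> code_dom R \<Delta> q \<and> map (cls R \<Delta> q) bs \<in> defset (interp R \<Delta> q) (npar \<Gamma>) \<phi>"
    using p0 q0 by (intro exI[of _ "map rp p0"] exI[of _ q0]) (simp del: map_map)
  then have "concat (map rp p0) @ q0 \<in> defset R (npar ?G\<Delta>) ?par"
    using defset_comp_par[OF D(1) G(2) D(2) okR] by blast
  then have "defset R' (npar ?G\<Delta>) ?par \<noteq> {}"
    using elem_equiv_defset_nonempty[OF RR' fvp] by blast
  then obtain r where r: "r \<in> defset R' (npar ?G\<Delta>) ?par" by blast
  then obtain bs q where rq: "r = concat bs @ q" and q: "q \<in> defset R' (npar \<Delta>) \<psi>"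
    and bs: "set bs \<subseteq> code_dom R' \<Delta> q" "map (cls R' \<Delta> q) bs \<in> defset (interp R' \<Delta> q) (npar \<Gamma>) \<phi>"
    using defset_comp_par[OF D(1) G(2) D(2) okR'] by blast

  let ?Z = "interp R' \<Delta> q" and ?p = "map (cls R' \<Delta> q) bs"
  have Z: "elem_equiv ?Z \<Z>"
    using RR' D(1,2) _ q
  proof (rule elem_equiv_interp)
    fix q assume "q \<in> defset R (npar \<Delta>) \<psi>"
    then show "interp_ok R \<Delta> q \<and> elem_equiv (interp R \<Delta> q) \<Z>"
      using D(4) isomorphic_elem_equiv interp_ok_closed_struct by blast
  qed
  have "ring \<Z>" by (rule cring.axioms(1)[OF int_is_cring])
  then have ring: "ring ?Z"
    using elem_equiv_sym[OF Z] interp_ok_closed_struct[OF okR'[OF q]] by (rule ring_elem_equiv)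
  \<comment> \<open>This second transfer of well-definedness goes from \<Z> to the structure
    interpreted in \<open>R'\<close>.\<close>
  have ok: "interp_ok ?Z \<Gamma> ?p"
    using elem_equiv_interp_ok[OF elem_equiv_sym[OF Z] G(1,2,4) bs(2)] .

  have code: "is_code ?G\<Delta>" by (rule is_code_comp_code[OF G(1) D(1)])
  have "sat R' r (coord_fm \<theta>\<^sub>R ?G\<Delta>)"
    using RR' fvp fv_coord_fm[OF code th(1)] _ r
  proof (rule elem_equiv_transfer_defset)
    fix e assume e: "e \<in> defset R (npar ?G\<Delta>) ?par"
    then have "length e = npar ?G\<Delta>" by (simp add: defset_def tuples_def)
    then show "sat R e (coord_fm \<theta>\<^sub>R ?G\<Delta>)"
      using sat_coord_fm[OF code th(1)] coord_graph_of_defines_coordinate_map[OF th(2)[OF e]] by blast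
  qed
  moreover have "length r = npar ?G\<Delta>" using r by (simp add: defset_def tuples_def)
  ultimately have "coord_graph \<theta>\<^sub>R R' ?G\<Delta> (concat bs @ q)"
    using sat_coord_fm[OF code th(1)] rq by blast
  moreover have "length q = npar \<Delta>" "length bs = npar \<Gamma>"
    using q bs(2) by (simp_all add: defset_def tuples_def)
  ultimately have "isomorphic R' (interp ?Z \<Gamma> ?p)"
    by (intro isomorphic_interp_of_coord_graph[OF G(1) D(1) okR'[OF q] _ bs(1) _ ok
        ring_closed_struct[OF assms(5)]])
  then show ?thesis using ring Z bs(2) ok by blast
qed

end
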